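(* Let $X$ be a space admitting a continuous transitive action $\theta:G\times X\to X$ of an $\omega$-narrow semitopological group $G$ such that $X$ has a $G$-compactification (with respect to $\theta$). Then: (1) $X$ is skeletally Dugundji provided it contains a dense Čech-complete $k$-separable subspace; (2) $X$ is openly Dugundji if $X$ is Čech-complete and $\sigma$-compact.
   Context: All spaces are Tychonoff (including the underlying spaces of groups). A semitopological group is a group $G$ with a topology making the multiplication $G\times G\to G$ separately continuous. It is $\omega$-narrow if for every neighborhood $U$ of the neutral element there is a countable set $A\subset G$ with $UA=AU=G$. Actions are left actions $\theta:G\times X\to X$, written $\theta(g,x)=gx$; an action is continuous if $\theta$ is (jointly) continuous, and transitive if for every $x\in X$ the map $\theta^x:G\to X$, $\theta^x(g)=gx$, is surjective. A $G$-compactification (equivariant compactification) of $X$ is a compactification $\widetilde X$ of $X$ such that $\theta$ extends to a continuous action $\widetilde\theta:G\times\widetilde X\to\widetilde X$. A space is $k$-separable if it contains a dense $\sigma$-compact subset. A continuous map $f:X\to Y$ is skeletal if $\operatorname{Int}\overline{f(U)}\neq\varnothing$ for every nonempty open $U\subset X$ (closure and interior in $Y$). A space $X$ is skeletally (resp., openly) Dugundji if there is a well-ordered inverse system $S=\{X_\alpha,p^\beta_\alpha,\alpha<\beta<\tau\}$, $\tau$ a cardinal (indices are ordinals below $\tau$), with surjective skeletal (resp., open) continuous bonding maps $p^\beta_\alpha:X_\beta\to X_\alpha$, such that: (i) $X_0$ is separable metrizable and every $p^{\alpha+1}_\alpha$ has a metrizable kernel, i.e. there is a separable metrizable space $M_\alpha$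 such that $X_{\alpha+1}$ is embedded in $X_\alpha\times M_\alpha$ and $p^{\alpha+1}_\alpha$ is the restriction to $X_{\alpha+1}$ of the projection $X_\alpha\times M_\alpha\to X_\alpha$; (ii) for every (nonzero) limit ordinal $\gamma<\tau$, $X_\gamma$ is a (dense) subspace of $\varprojlim\{X_\alpha,p^\beta_\alpha,\alpha<\beta<\gamma\}$ (via the natural map induced by the $p^\gamma_\alpha$); (iii) $X$ is embedded in $\varprojlim S$ so that $p_\alpha(X)=X_\alpha$ for each $\alpha$, where $p_\alpha:\varprojlim S\to X_\alpha$ is the limit projection; (iv) for every bounded continuous real-valued function $f$ on $\varprojlim S$ there are $\alpha<\tau$ and a continuous function $g$ on $X_\alpha$ with $f=g\circ p_\alpha$. *)

theory Defs
  imports "HOL-Analysis.Analysis" "HOL-Algebra.Group_Action"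
begin

section \<open>Topological preliminaries\<close>

definition tychonoff_space :: "'a topology \<Rightarrow> bool" where
  "tychonoff_space X \<longleftrightarrow> completely_regular_space X \<and> Hausdorff_space X"

definition dense_in :: "'a topology \<Rightarrow> 'a set \<Rightarrow> bool" where
  "dense_in X D \<longleftrightarrow> D \<subseteq> topspace X \<and> X closure_of D = topspace X"

definition sigma_compact_space :: "'a topology \<Rightarrow> bool" where
  "sigma_compact_space X \<longleftrightarrow> (countable union_of compactin X) (topspace X)"

definition k_separable_space :: "'a topology \<Rightarrow> bool" where
  "k_separable_space X \<longleftrightarrow> (\<exists>D. dense_in X D \<and> sigma_compact_space (subtopology X D))"

definition compactification :: "'a topology \<Rightarrow> 'k topology \<Rightarrow> ('a \<Rightarrow> 'k) \<Rightarrow> bool" where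
  "compactification X K c \<longleftrightarrow>
     compact_space K \<and> Hausdorff_space K \<and> embedding_map X K c \<and> dense_in K (c ` topspace X)"

text \<open>The Stone--Cech compactification of a Tychonoff space, realised as the closure of the
  image of \<open>X\<close> in the cube indexed by all continuous functions from \<open>X\<close> to the unit interval.\<close>

definition unit_functions :: "'a topology \<Rightarrow> ('a \<Rightarrow> real) set" where
  "unit_functions X =
     {f \<in> extensional (topspace X). continuous_map X (top_of_set {0..1}) f}"

definition stone_cech_map :: "'a topology \<Rightarrow> 'a \<Rightarrow> ('a \<Rightarrow> real) \<Rightarrow> real" where
  "stone_cech_map X x = (\<lambda>f\<in>unit_functions X. f x)"

definition stone_cech :: "'a topology \<Rightarrow> (('a \<Rightarrow> real) \<Rightarrow> real) topology" where
  "stone_cech X =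
     (let Q = product_topology (\<lambda>_. top_of_set {0..1}) (unit_functions X)
      in subtopology Q (Q closure_of (stone_cech_map X ` topspace X)))"

definition cech_complete_space :: "'a topology \<Rightarrow> bool" where
  "cech_complete_space X \<longleftrightarrow>
     tychonoff_space X \<and> gdelta_in (stone_cech X) (stone_cech_map X ` topspace X)"

definition skeletal_map :: "'a topology \<Rightarrow> 'b topology \<Rightarrow> ('a \<Rightarrow> 'b) \<Rightarrow> bool" where
  "skeletal_map X Y f \<longleftrightarrow>
     continuous_map X Y f \<and>
     (\<forall>U. openin X U \<and> U \<noteq> {} \<longrightarrow> Y interior_of (Y closure_of (f ` U)) \<noteq> {})"


section \<open>Semitopological groups and their actions\<close>

definition semitopological_group :: "('g, 'm) monoid_scheme \<Rightarrow> 'g topology \<Rightarrow> bool" where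
  "semitopological_group G T \<longleftrightarrow>
     group G \<and> topspace T = carrier G \<and>
     (\<forall>g\<in>carrier G. continuous_map T T (\<lambda>x. g \<otimes>\<^bsub>G\<^esub> x) \<and> continuous_map T T (\<lambda>x. x \<otimes>\<^bsub>G\<^esub> g))"

definition omega_narrow :: "('g, 'm) monoid_scheme \<Rightarrow> 'g topology \<Rightarrow> bool" where
  "omega_narrow G T \<longleftrightarrow>
     (\<forall>U. U \<subseteq> carrier G \<and> (\<exists>V. openin T V \<and> \<one>\<^bsub>G\<^esub> \<in> V \<and> V \<subseteq> U) \<longrightarrow>
        (\<exists>A. countable A \<and> A \<subseteq> carrier G \<and>
             U <#>\<^bsub>G\<^esub> A = carrier G \<and> A <#>\<^bsub>G\<^esub> U = carrier G))"

definition continuous_action ::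
    "('g, 'm) monoid_scheme \<Rightarrow> 'g topology \<Rightarrow> 'a topology \<Rightarrow> ('g \<Rightarrow> 'a \<Rightarrow> 'a) \<Rightarrow> bool" where
  "continuous_action G T X \<theta> \<longleftrightarrow>
     group_action G (topspace X) \<theta> \<and>
     continuous_map (prod_topology T X) X (\<lambda>(g, x). \<theta> g x)"

definition equivariant_compactification ::
    "('g, 'm) monoid_scheme \<Rightarrow> 'g topology \<Rightarrow> 'a topology \<Rightarrow> ('g \<Rightarrow> 'a \<Rightarrow> 'a) \<Rightarrow>
     'k topology \<Rightarrow> ('a \<Rightarrow> 'k) \<Rightarrow> bool" where
  "equivariant_compactification G T X \<theta> K c \<longleftrightarrow>
     compactification X K c \<and>
     (\<exists>\<theta>'. continuous_action G T K \<theta>' \<and>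
           (\<forall>g\<in>carrier G. \<forall>x\<in>topspace X. \<theta>' g (c x) = c (\<theta> g x)))"


section \<open>Well-ordered inverse systems\<close>

text \<open>The ordinals below a cardinal are the elements of the field of a cardinal order \<open>r\<close>, so
  that \<open>underS r \<beta>\<close> is the set of indices strictly below \<open>\<beta>\<close>. The bonding map from \<open>Xs \<beta>\<close> to
  \<open>Xs \<alpha>\<close>, for \<open>\<alpha>\<close> strictly below \<open>\<beta>\<close>, is \<open>p \<alpha> \<beta>\<close>.\<close>

definition is_successor :: "'i rel \<Rightarrow> 'i \<Rightarrow> 'i \<Rightarrow> bool" where
  "is_successor r \<alpha> \<beta> \<longleftrightarrow> \<alpha> \<in> Field r \<and> \<beta> \<in> Field r \<and> underS r \<beta> = under r \<alpha>"

definition is_limit :: "'i rel \<Rightarrow> 'i \<Rightarrow> bool" where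
  "is_limit r \<gamma> \<longleftrightarrow> \<gamma> \<in> Field r \<and> underS r \<gamma> \<noteq> {} \<and> \<not> (\<exists>\<alpha>. is_successor r \<alpha> \<gamma>)"

definition inverse_limit ::
    "'i rel \<Rightarrow> 'i set \<Rightarrow> ('i \<Rightarrow> 'a topology) \<Rightarrow> ('i \<Rightarrow> 'i \<Rightarrow> 'a \<Rightarrow> 'a) \<Rightarrow> ('i \<Rightarrow> 'a) topology" where
  "inverse_limit r I Xs p =
     subtopology (product_topology Xs I) {x. \<forall>\<beta>\<in>I. \<forall>\<alpha>\<in>underS r \<beta> \<inter> I. p \<alpha> \<beta> (x \<beta>) = x \<alpha>}"

definition inverse_system ::
    "'i rel \<Rightarrow> ('i \<Rightarrow> 'a topology) \<Rightarrow> ('i \<Rightarrow> 'i \<Rightarrow> 'a \<Rightarrow> 'a) \<Rightarrow> bool" where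
  "inverse_system r Xs p \<longleftrightarrow>
     (\<forall>\<alpha>\<in>Field r. tychonoff_space (Xs \<alpha>)) \<and>
     (\<forall>\<beta>\<in>Field r. \<forall>\<alpha>\<in>underS r \<beta>. continuous_map (Xs \<beta>) (Xs \<alpha>) (p \<alpha> \<beta>)) \<and>
     (\<forall>\<gamma>\<in>Field r. \<forall>\<beta>\<in>underS r \<gamma>. \<forall>\<alpha>\<in>underS r \<beta>. \<forall>x\<in>topspace (Xs \<gamma>).
        p \<alpha> \<beta> (p \<beta> \<gamma> x) = p \<alpha> \<gamma> x)"

text \<open>The space \<open>M\<close> may be taken to have an underlying set of functions from the naturals to the
  reals, since a separable metrizable space has at most continuum many points.\<close>

definition metrizable_kernel :: "'a topology \<Rightarrow> 'b topology \<Rightarrow> ('a \<Rightarrow> 'b) \<Rightarrow> bool" where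
  "metrizable_kernel Y Z q \<longleftrightarrow>
     (\<exists>(M :: (nat \<Rightarrow> real) topology) m.
        metrizable_space M \<and> separable_space M \<and>
        embedding_map Y (prod_topology Z M) (\<lambda>y. (q y, m y)))"

text \<open>The clauses other than the class \<open>Q\<close> of bonding maps are common to skeletally and openly
  Dugundji spaces. Every \<open>Xs \<alpha>\<close> is an image of \<open>X\<close>, hence can be carried by a set of points of
  type \<open>'a\<close>. The chain of topologies induced on \<open>X\<close> by the projections has, up to repetitions,
  at most as many members as \<open>X\<close> has subsets; indices are taken from \<open>'a set set\<close>, which leaves
  room for the successor cardinal.\<close>

definition dugundji_wrt ::
    "('a topology \<Rightarrow> 'a topology \<Rightarrow> ('a \<Rightarrow> 'a) \<Rightarrow> bool) \<Rightarrow> 'a topology \<Rightarrow> bool" where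
  "dugundji_wrt Q X \<longleftrightarrow>
     (\<exists>(r :: 'a set set rel) Xs p.
        Card_order r \<and> Field r \<noteq> {} \<and> inverse_system r Xs p \<and>
        (\<forall>\<beta>\<in>Field r. \<forall>\<alpha>\<in>underS r \<beta>.
           p \<alpha> \<beta> ` topspace (Xs \<beta>) = topspace (Xs \<alpha>) \<and> Q (Xs \<beta>) (Xs \<alpha>) (p \<alpha> \<beta>)) \<and>
        (\<forall>\<alpha>\<in>Field r. underS r \<alpha> = {} \<longrightarrow> metrizable_space (Xs \<alpha>) \<and> separable_space (Xs \<alpha>)) \<and>
        (\<forall>\<alpha> \<beta>. is_successor r \<alpha> \<beta> \<longrightarrow> metrizable_kernel (Xs \<beta>) (Xs \<alpha>) (p \<alpha> \<beta>)) \<and>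
        (\<forall>\<gamma>. is_limit r \<gamma> \<longrightarrow>
           (let L = inverse_limit r (underS r \<gamma>) Xs p; j = (\<lambda>x. \<lambda>\<alpha>\<in>underS r \<gamma>. p \<alpha> \<gamma> x)
            in embedding_map (Xs \<gamma>) L j \<and> dense_in L (j ` topspace (Xs \<gamma>)))) \<and>
        (let L = inverse_limit r (Field r) Xs p in
           (\<exists>e. embedding_map X L e \<and>
                (\<forall>\<alpha>\<in>Field r. (\<lambda>x. e x \<alpha>) ` topspace X = topspace (Xs \<alpha>))) \<and>
           (\<forall>f. continuous_map L euclideanreal f \<and> bounded (f ` topspace L) \<longrightarrow>
                (\<exists>\<alpha>\<in>Field r. \<exists>g. continuous_map (Xs \<alpha>) euclideanreal g \<and>
                                (\<forall>x\<in>topspace L. f x = g (x \<alpha>))))))"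

definition skeletally_dugundji :: "'a topology \<Rightarrow> bool" where
  "skeletally_dugundji X \<longleftrightarrow> dugundji_wrt skeletal_map X"

definition openly_dugundji :: "'a topology \<Rightarrow> bool" where
  "openly_dugundji X \<longleftrightarrow> dugundji_wrt open_map X"

end

theory Submission
  imports Defs
begin

text \<open>
  Let \<open>K\<close> be an equivariant compactification of \<open>X\<close>. Every family \<open>A\<close> of continuous real functions
  on \<open>K\<close> has a Tychonoff quotient of \<open>X\<close>, in which the points that \<open>A\<close> does not separate are
  identified and whose topology is generated by \<open>A\<close>. All spaces of the inverse system are such
  quotients, taken along an increasing chain of families. If each step adds countably many functions,
  the bonding maps have metrizable kernels; if the family at a limit stage is the union of the earlier
  ones, the space there embeds densely into the limit. As soon as the chain has exhausted a set of
  functions that generates the topology of \<open>X\<close>, the quotient is \<open>X\<close> and stays so. The indices run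
  through a cardinal that is larger than that set, hence the limit of the whole system is \<open>X\<close> too, and
  every function on it factors through a stage. All this is \<open>dugundji_wrt_separated_quotients\<close>. It
  leaves one question: for which families, closed under unions and built from countable ones, is the
  projection from \<open>X\<close> onto the quotient skeletal, or open?

  The group supplies the families. As the action on \<open>K\<close> is continuous and \<open>K\<close> is compact, the
  functions \<open>f \<circ> g\<close> are uniformly close to \<open>f\<close> for \<open>g\<close> near the neutral element; as \<open>G\<close> is
  \<open>\<omega>\<close>-narrow, the orbit of \<open>f\<close> is therefore separable in the uniform norm. A union of countable dense
  parts of orbits generates a topology on which \<open>G\<close> acts by homeomorphisms.

  For such families the projection is nearly open (\<open>nearly_open\<close>): a point \<open>x\<close> of an open set \<open>W\<close> is
  interior to the closure of \<open>W\<close> in the coarse topology. Choose \<open>f\<close> with \<open>f x = 0\<close> and \<open>f = 1\<close> off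
  \<open>W\<close>, and let \<open>U\<close> consist of the \<open>g\<close> that move \<open>f\<close> by at most \<open>1/3\<close>. Countably many translates
  \<open>d U x\<close> cover the orbit \<open>X\<close> of \<open>x\<close>, so by Baire category one of them is somewhere dense. Hence the
  interior of its closure contains some \<open>d u x\<close>, and applying the inverse of \<open>d u\<close> shows that \<open>x\<close> is
  interior to the closure of the points \<open>u\<inverse> v x\<close> with \<open>v \<in> U\<close>, at which \<open>f\<close> is at most \<open>2/3\<close>. Inversion in
  \<open>G\<close> need not be continuous; its place is taken by the symmetry of \<open>U\<close>, which holds because \<open>f \<circ> g - f\<close>
  and \<open>f - f \<circ> g\<inverse>\<close> have the same uniform norm.

  Baire category is available in \<open>K\<close>, which is compact in the coarse topology as well, but the
  translates cover only \<open>X\<close>. So \<open>X\<close> has to contain a countable intersection of dense sets that are open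
  in the coarse topology. Cech-completeness makes the given subspace \<open>Y\<close> a countable intersection of open
  sets \<open>V\<close> of \<open>K\<close> (\<open>cech_complete_gdelta_in_compactification\<close>), and \<open>k\<close>-separability gives countably
  many compact sets \<open>C \<subseteq> Y\<close> with dense union. Every family is made to contain the countably many
  Urysohn functions that are \<open>0\<close> on some \<open>C\<close> and \<open>1\<close> off some \<open>V\<close>; for a fixed \<open>V\<close>, the points at
  which one of them is below \<open>1\<close> form the required dense set.

  Nearly open maps are skeletal. If moreover \<open>Y = X\<close> is the union of the sets \<open>C\<close>, the same functions
  show that \<open>X\<close> is saturated in \<open>K\<close>; since compact sets have closed images in a Hausdorff
  quotient, the closure in the definition of near openness can then be absorbed into \<open>W\<close>, and the projection
  is open.
\<close>

section \<open>Topologies generated by real functions\<close>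

definition initial_topology :: "'a set \<Rightarrow> ('a \<Rightarrow> real) set \<Rightarrow> 'a topology" where
  "initial_topology S A =
     pullback_topology S (\<lambda>x. \<lambda>f\<in>A. f x) (product_topology (\<lambda>_. euclideanreal) A)"

lemma topspace_initial_topology [simp]: "topspace (initial_topology S A) = S"
  by (auto simp: initial_topology_def topspace_pullback_topology)

lemma continuous_map_initial_topology:
  assumes "f \<in> A"
  shows "continuous_map (initial_topology S A) euclideanreal f"
proof -
  have "continuous_map (initial_topology S A) euclideanreal ((\<lambda>h. h f) \<circ> (\<lambda>x. \<lambda>f\<in>A. f x))"
    unfolding initial_topology_def
    by (intro continuous_map_pullback continuous_map_product_projection assms)
  then show ?thesis
    using assms by (simp add: o_def)
qed

lemma continuous_map_into_initial_topology:
  assumes "h \<in> topspace Y \<rightarrow> S"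
    and "\<And>f. f \<in> A \<Longrightarrow> continuous_map Y euclideanreal (\<lambda>y. f (h y))"
  shows "continuous_map Y (initial_topology S A) h"
  unfolding initial_topology_def
proof (rule continuous_map_pullback')
  show "continuous_map Y (product_topology (\<lambda>_. euclideanreal) A) ((\<lambda>x. \<lambda>f\<in>A. f x) \<circ> h)"
    using assms(2) by (auto simp: continuous_map_componentwise)
qed (use assms(1) in auto)

lemma openin_initial_topology_saturated:
  assumes "openin (initial_topology S A) U" "x \<in> U" "y \<in> S" "\<And>f. f \<in> A \<Longrightarrow> f y = f x"
  shows "y \<in> U"
proof -
  obtain V where V: "U = (\<lambda>x. \<lambda>f\<in>A. f x) -` V \<inter> S"
    using assms(1) unfolding initial_topology_def openin_pullback_topology by auto
  have "(\<lambda>f\<in>A. f y) = (\<lambda>f\<in>A. f x)"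
    using assms(4) by auto
  then show ?thesis
    using V assms(2,3) by auto
qed

text \<open>Regularity does not presuppose separation of points, so the Baire category theorem applies to a
  compact space with an initial topology directly, before points are identified.\<close>
lemma regular_space_initial_topology: "regular_space (initial_topology S A)"
proof -
  let ?P = "product_topology (\<lambda>_. euclideanreal) A"
  let ?e = "\<lambda>x. \<lambda>f\<in>A. f x"
  have reg: "regular_space ?P"
    by (simp add: completely_regular_imp_regular_space completely_regular_space_product_topology
        metrizable_imp_completely_regular_space
        metrizable_space_euclidean)
  show ?thesis
    unfolding regular_space
  proof (intro allI impI)
    fix C a assume *: "closedin (initial_topology S A) C \<and> a \<in> topspace (initial_topology S A) - C"
    then have "openin (initial_topology S A) (S - C)" "a \<in> S - C"
      by (auto simp: closedin_def)
    then obtain V where V: "openin ?P V" "S - C = ?e -` V \<inter> S"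
      unfolding initial_topology_def openin_pullback_topology by auto
    then have "?e a \<in> V"
      using \<open>a \<in> S - C\<close> by auto
    moreover have "V \<subseteq> topspace ?P"
      by (rule openin_subset [OF V(1)])
    ultimately have "closedin ?P (topspace ?P - V) \<and> ?e a \<in> topspace ?P - (topspace ?P - V)"
      using V(1) by blast
    then obtain U where U: "openin ?P U" "?e a \<in> U" "disjnt (topspace ?P - V) (?P closure_of U)"
      using reg unfolding regular_space by meson
    then have clU: "?P closure_of U \<subseteq> V"
      using closure_of_subset_topspace [of ?P U] unfolding disjnt_iff by blast
    have cont: "continuous_map (initial_topology S A) ?P ?e"
      by (auto simp: continuous_map_componentwise intro: continuous_map_initial_topology)
    let ?U = "{x \<in> S. ?e x \<in> U}" and ?F = "{x \<in> S. ?e x \<in> ?P closure_of U}"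
    have "openin (initial_topology S A) ?U"
      using openin_continuous_map_preimage [OF cont U(1)] by simp
    moreover have "closedin (initial_topology S A) ?F"
      using closedin_continuous_map_preimage [OF cont closedin_closure_of] by simp
    then have "initial_topology S A closure_of ?U \<subseteq> ?F"
      using closure_of_subset [OF openin_subset [OF U(1)]]
      by (intro closure_of_minimal) auto
    moreover have "?F \<subseteq> S - C"
      using clU V(2) by auto
    ultimately show "\<exists>U. openin (initial_topology S A) U \<and> a \<in> U \<and>
                disjnt C (initial_topology S A closure_of U)"
      using U(2) \<open>a \<in> S - C\<close> by (intro exI [of _ ?U]) (auto simp: disjnt_iff)
  qed
qed

lemma compact_space_initial_topology:
  assumes "compact_space K" "\<And>f. f \<in> A \<Longrightarrow> continuous_map K euclideanreal f"
  shows "compact_space (initial_topology (topspace K) A)"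
proof -
  have "continuous_map K (initial_topology (topspace K) A) (\<lambda>x. x)"
    using assms(2) by (intro continuous_map_into_initial_topology) auto
  then have "compactin (initial_topology (topspace K) A) ((\<lambda>x. x) ` topspace K)"
    using assms(1) image_compactin unfolding compact_space_def by blast
  then show ?thesis
    by (simp add: compact_space_def)
qed

lemma openin_initial_topology_pullback:
  assumes "openin (initial_topology E ((\<lambda>f. f \<circ> c) ` A)) U" "c ` E \<subseteq> S"
  obtains V where "openin (initial_topology S A) V" "U = {x \<in> E. c x \<in> V}"
proof -
  let ?P = "pullback_topology E c (initial_topology S A)"
  have top: "topspace ?P = E"
    using assms(2) by (auto simp: topspace_pullback_topology)
  have "continuous_map ?P (initial_topology E ((\<lambda>f. f \<circ> c) ` A)) (\<lambda>x. x)"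
  proof (rule continuous_map_into_initial_topology)
    fix f assume "f \<in> (\<lambda>f. f \<circ> c) ` A"
    then obtain f' where "f' \<in> A" "f = f' \<circ> c" by blast
    then show "continuous_map ?P euclideanreal (\<lambda>x. f x)"
      using continuous_map_pullback [OF continuous_map_initial_topology, of f' A E c S]
      by (simp add: o_def)
  qed (use top in auto)
  then have "openin ?P {x \<in> topspace ?P. x \<in> U}"
    using assms(1) by (rule openin_continuous_map_preimage)
  moreover have "{x \<in> topspace ?P. x \<in> U} = U"
    using openin_subset [OF assms(1)] by (auto simp: top)
  ultimately show thesis
    using that unfolding openin_pullback_topology by (auto simp: Int_def vimage_def conj_commute)
qed

lemma openin_initial_topology_preimage:
  assumes "openin (initial_topology S A) V" "c ` E \<subseteq> S"
  shows "openin (initial_topology E ((\<lambda>f. f \<circ> c) ` A)) {x \<in> E. c x \<in> V}"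
proof -
  have "continuous_map (initial_topology E ((\<lambda>f. f \<circ> c) ` A)) (initial_topology S A) c"
  proof (rule continuous_map_into_initial_topology)
    fix f assume "f \<in> A"
    then have "continuous_map (initial_topology E ((\<lambda>f. f \<circ> c) ` A)) euclideanreal (f \<circ> c)"
      by (intro continuous_map_initial_topology) blast
    then show "continuous_map (initial_topology E ((\<lambda>f. f \<circ> c) ` A)) euclideanreal (\<lambda>x. f (c x))"
      by (simp add: o_def)
  qed (use assms(2) in auto)
  from openin_continuous_map_preimage [OF this assms(1)] show ?thesis
    by simp
qed

text \<open>The evaluation map into the product of lines sends \<open>C\<close> to a compact, hence closed set, whose
  preimage is closed in the initial topology and contains \<open>C\<close>.\<close>
lemma closure_of_compactin_initial_topology:
  assumes "compactin K C" "\<And>f. f \<in> A \<Longrightarrow> continuous_map K euclideanreal f"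
    and z: "z \<in> initial_topology (topspace K) A closure_of C"
  shows "\<exists>y\<in>C. \<forall>f\<in>A. f y = f z"
proof -
  let ?P = "product_topology (\<lambda>_. euclideanreal) A" and ?e = "\<lambda>x. \<lambda>f\<in>A. f x"
    and ?I = "initial_topology (topspace K) A"
  have "continuous_map K ?P ?e"
    using assms(2) by (auto simp: continuous_map_componentwise)
  then have "compactin ?P (?e ` C)"
    by (rule image_compactin [OF assms(1)])
  then have "closedin ?P (?e ` C)"
    by (intro compactin_imp_closedin) (simp_all add: Hausdorff_space_product_topology)
  moreover have "continuous_map ?I ?P ?e"
    by (auto simp: continuous_map_componentwise intro: continuous_map_initial_topology)
  ultimately have "closedin ?I {x \<in> topspace ?I. ?e x \<in> ?e ` C}"
    by (intro closedin_continuous_map_preimage [where Y = ?P])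
  moreover have "C \<subseteq> {x \<in> topspace ?I. ?e x \<in> ?e ` C}"
    using compactin_subset_topspace [OF assms(1)] by auto
  ultimately have "?I closure_of C \<subseteq> {x \<in> topspace ?I. ?e x \<in> ?e ` C}"
    by (meson closure_of_minimal)
  then obtain y where "y \<in> C" "?e z = ?e y"
    using z by blast
  then show ?thesis
    by (intro bexI [of _ y]) (auto simp: fun_eq_iff restrict_def split: if_splits dest: spec)
qed

section \<open>Separated quotients\<close>

text \<open>The quotient is carried by a set of representatives rather than by equivalence classes, so that
  all quotients of a space have points of the same type.\<close>
definition representative :: "'a set \<Rightarrow> ('a \<Rightarrow> real) set \<Rightarrow> 'a \<Rightarrow> 'a" where
  "representative S A x = (SOME y. y \<in> S \<and> (\<forall>f\<in>A. f y = f x))"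

definition separated_quotient :: "'a set \<Rightarrow> ('a \<Rightarrow> real) set \<Rightarrow> 'a topology" where
  "separated_quotient S A = subtopology (initial_topology S A) (representative S A ` S)"

lemma representative:
  assumes "x \<in> S"
  shows representative_in: "representative S A x \<in> S"
    and representative_eq: "f \<in> A \<Longrightarrow> f (representative S A x) = f x"
proof -
  have "representative S A x \<in> S \<and> (\<forall>f\<in>A. f (representative S A x) = f x)"
    unfolding representative_def by (rule someI [of _ x]) (use assms in auto)
  then show "representative S A x \<in> S"
    and "f \<in> A \<Longrightarrow> f (representative S A x) = f x" by auto
qed

lemma representative_cong:
  assumes "\<And>f. f \<in> A \<Longrightarrow> f x = f y"
  shows "representative S A x = representative S A y"
  using assms unfolding representative_def by metis

lemma representative_representative:
  assumes "x \<in> S" "A \<subseteq> B"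
  shows "representative S A (representative S B x) = representative S A x"
  using assms by (intro representative_cong representative_eq) auto

lemma topspace_separated_quotient [simp]:
  "topspace (separated_quotient S A) = representative S A ` S"
  by (auto simp: separated_quotient_def representative_in)

lemma representative_fixed:
  "x \<in> topspace (separated_quotient S A) \<Longrightarrow> representative S A x = x"
  by (auto simp: representative_representative)

lemma separated_quotient_in: "x \<in> topspace (separated_quotient S A) \<Longrightarrow> x \<in> S"
  by (auto simp: representative_in)

lemma representative_separating:
  assumes "\<And>x y. \<lbrakk>x \<in> S; y \<in> S; \<forall>f\<in>A. f x = f y\<rbrakk> \<Longrightarrow> x = y" "x \<in> S"
  shows "representative S A x = x"
  using assms representative_eq representative_in by metis

lemma continuous_map_separated_quotient:
  "f \<in> A \<Longrightarrow> continuous_map (separated_quotient S A) euclideanreal f"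
  by (simp add: separated_quotient_def continuous_map_from_subtopology continuous_map_initial_topology)

lemma continuous_map_representative:
  assumes "topspace Y \<subseteq> S" "\<And>f. f \<in> A \<Longrightarrow> continuous_map Y euclideanreal f"
  shows "continuous_map Y (separated_quotient S A) (representative S A)"
proof -
  have "continuous_map Y (initial_topology S A) (representative S A)"
  proof (rule continuous_map_into_initial_topology)
    show "representative S A \<in> topspace Y \<rightarrow> S"
      using assms(1) by (auto intro: representative_in)
    show "continuous_map Y euclideanreal (\<lambda>y. f (representative S A y))" if "f \<in> A" for f
      by (rule continuous_map_eq [OF assms(2) [OF that]])
        (use assms(1) that in \<open>auto simp: representative_eq\<close>)
  qed
  then show ?thesis
    using assms(1) by (auto simp: separated_quotient_def continuous_map_in_subtopology)
qed

lemma continuous_map_representative_mono: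
  assumes "A \<subseteq> B"
  shows "continuous_map (separated_quotient S B) (separated_quotient S A) (representative S A)"
  using assms
  by (intro continuous_map_representative continuous_map_separated_quotient)
    (auto simp: representative_in)

text \<open>Injectivity and continuity of the inverse both follow as soon as every function of the family
  factors through \<open>h\<close>. All embeddings of quotients below are recognised in this way.\<close>
lemma embedding_map_separated_quotient:
  assumes h: "continuous_map (separated_quotient S A) Z h"
    and g: "\<And>f. f \<in> A \<Longrightarrow> \<exists>g. continuous_map Z euclideanreal g \<and>
              (\<forall>x\<in>topspace (separated_quotient S A). g (h x) = f x)"
  shows "embedding_map (separated_quotient S A) Z h"
proof -
  let ?Q = "separated_quotient S A"
  have inj: "inj_on h (topspace ?Q)"
  proof (rule inj_onI)
    fix x y assume xy: "x \<in> topspace ?Q" "y \<in> topspace ?Q" "h x = h y"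
    have "f x = f y" if "f \<in> A" for f
      using g [OF that] xy by metis
    then have "representative S A x = representative S A y"
      by (rule representative_cong)
    then show "x = y"
      using xy representative_fixed by metis
  qed
  define k where "k = inv_into (topspace ?Q) h"
  have k: "k (h x) = x" if "x \<in> topspace ?Q" for x
    using inj that by (simp add: k_def)
  let ?Z = "subtopology Z (h ` topspace ?Q)"
  have topZ: "topspace ?Z = h ` topspace ?Q"
    using continuous_map_image_subset_topspace [OF h] by auto
  have "continuous_map ?Z (initial_topology S A) k"
  proof (rule continuous_map_into_initial_topology)
    show "k \<in> topspace ?Z \<rightarrow> S"
      unfolding topZ by (auto simp: k simp del: topspace_separated_quotient dest: separated_quotient_in)
    fix f assume "f \<in> A"
    then obtain g where g: "continuous_map Z euclideanreal g" "\<forall>x\<in>topspace ?Q. g (h x) = f x"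
      using assms(2) by blast
    have "continuous_map ?Z euclideanreal g"
      by (rule continuous_map_from_subtopology [OF g(1)])
    then show "continuous_map ?Z euclideanreal (\<lambda>y. f (k y))"
      by (rule continuous_map_eq) (unfold topZ, use g(2) k in auto)
  qed
  then have "continuous_map ?Z ?Q k"
    unfolding separated_quotient_def [of S A] continuous_map_in_subtopology
    using topZ k by (auto simp: separated_quotient_def [symmetric] simp del: topspace_separated_quotient)
      (simp_all)
  then have "homeomorphic_maps ?Q ?Z h k"
    using h k unfolding homeomorphic_maps_def continuous_map_in_subtopology topZ by auto
  then show ?thesis
    unfolding embedding_map_def using homeomorphic_maps_map by blast
qed

lemma tychonoff_space_separated_quotient: "tychonoff_space (separated_quotient S A)"
proof -
  let ?P = "product_topology (\<lambda>_. euclideanreal) A" and ?Q = "separated_quotient S A"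
  have "embedding_map ?Q ?P (\<lambda>x. \<lambda>f\<in>A. f x)"
  proof (rule embedding_map_separated_quotient)
    show "continuous_map ?Q ?P (\<lambda>x. \<lambda>f\<in>A. f x)"
      by (auto simp: continuous_map_componentwise intro: continuous_map_separated_quotient)
    show "\<exists>g. continuous_map ?P euclideanreal g \<and> (\<forall>x\<in>topspace ?Q. g (\<lambda>f\<in>A. f x) = f x)"
      if "f \<in> A" for f
      using that by (intro exI [of _ "\<lambda>h. h f"]) (auto intro: continuous_map_product_projection)
  qed
  then obtain T where T: "?Q homeomorphic_space subtopology ?P T"
    using embedding_map_imp_homeomorphic_space by blast
  have "completely_regular_space ?P" "Hausdorff_space ?P"
    by (simp_all add: completely_regular_space_product_topology Hausdorff_space_product_topology
        metrizable_imp_completely_regular_space metrizable_space_euclidean)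
  then show ?thesis
    using T unfolding tychonoff_space_def
    by (meson completely_regular_space_subtopology Hausdorff_space_subtopology
        homeomorphic_Hausdorff_space homeomorphic_completely_regular_space)
qed

lemma metrizable_second_countable_real_sequences:
  "metrizable_space (product_topology (\<lambda>_. euclideanreal) (UNIV :: nat set))"
  "second_countable (product_topology (\<lambda>_. euclideanreal) (UNIV :: nat set))"
proof -
  have eq: "product_topology (\<lambda>_. euclideanreal) (UNIV :: nat set) = euclidean"
    by (simp add: euclidean_product_topology)
  show "metrizable_space (product_topology (\<lambda>_. euclideanreal) (UNIV :: nat set))"
    unfolding eq by (rule metrizable_space_euclidean)
  obtain \<B> :: "(nat \<Rightarrow> real) set set" where \<B>: "countable \<B>" "topological_basis \<B>"
    using ex_countable_basis by blast
  show "second_countable (product_topology (\<lambda>_. euclideanreal) (UNIV :: nat set))"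
    unfolding eq second_countable_def
  proof (intro exI conjI ballI allI impI)
    show "openin euclidean V" if "V \<in> \<B>" for V
      using topological_basis_open [OF \<B>(2) that] by simp
    show "\<exists>V\<in>\<B>. x \<in> V \<and> V \<subseteq> U" if "openin euclidean U \<and> x \<in> U" for U x
      using topological_basisE [OF \<B>(2)] that by (metis open_openin)
  qed (rule \<B>(1))
qed

lemma metrizable_kernel_separated_quotient:
  assumes "countable N"
  shows "metrizable_kernel (separated_quotient S (A \<union> N)) (separated_quotient S A)
           (representative S A)"
proof -
  \<comment> \<open>The zero function makes the family nonempty, so that it can be enumerated by the naturals.\<close>
  define N' where "N' = insert (\<lambda>_. 0) N"
  have N': "countable N'" "N' \<noteq> {}"
    using assms by (auto simp: N'_def)
  define m :: "'a \<Rightarrow> nat \<Rightarrow> real" where "m y = (\<lambda>n. from_nat_into N' n y)" for y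
  let ?M = "product_topology (\<lambda>_. euclideanreal) (UNIV :: nat set)"
  let ?B = "separated_quotient S (A \<union> N)" and ?A = "separated_quotient S A"
  have "embedding_map ?B (prod_topology ?A ?M) (\<lambda>y. (representative S A y, m y))"
  proof (rule embedding_map_separated_quotient)
    have "continuous_map ?B ?A (representative S A)"
      by (rule continuous_map_representative_mono) auto
    moreover have "continuous_map ?B ?M m"
    proof -
      have "continuous_map ?B euclideanreal (from_nat_into N' n)" for n
        using from_nat_into [OF N'(2), of n] unfolding N'_def
        by (auto intro: continuous_map_separated_quotient)
      then show ?thesis
        by (simp add: continuous_map_componentwise_UNIV m_def)
    qed
    ultimately show "continuous_map ?B (prod_topology ?A ?M) (\<lambda>y. (representative S A y, m y))"
      by (simp add: continuous_map_pairedI)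
    fix f assume f: "f \<in> A \<union> N"
    show "\<exists>g. continuous_map (prod_topology ?A ?M) euclideanreal g \<and>
            (\<forall>x\<in>topspace ?B. g (representative S A x, m x) = f x)"
    proof (cases "f \<in> A")
      case True
      then have "continuous_map (prod_topology ?A ?M) euclideanreal (f \<circ> fst)"
        by (intro continuous_map_compose [OF continuous_map_fst continuous_map_separated_quotient])
      then show ?thesis
        using True by (intro exI [of _ "f \<circ> fst"]) (auto simp: representative_eq representative_in)
    next
      case False
      then obtain n where n: "from_nat_into N' n = f"
        using f from_nat_into_surj [OF N'(1), of f] unfolding N'_def by blast
      have "continuous_map (prod_topology ?A ?M) euclideanreal ((\<lambda>h. h n) \<circ> snd)"
        by (intro continuous_map_compose [OF continuous_map_snd continuous_map_product_projection]) simp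
      then show ?thesis
        using n by (intro exI [of _ "(\<lambda>h. h n) \<circ> snd"]) (auto simp: m_def)
    qed
  qed
  moreover have "separable_space ?M"
    by (intro second_countable_imp_separable_space metrizable_second_countable_real_sequences)
  ultimately show ?thesis
    unfolding metrizable_kernel_def using metrizable_second_countable_real_sequences(1) by blast
qed

lemma metrizable_separable_separated_quotient:
  assumes "countable A"
  shows "metrizable_space (separated_quotient S A)" "separable_space (separated_quotient S A)"
proof -
  let ?M = "product_topology (\<lambda>_. euclideanreal) (UNIV :: nat set)" and ?Q = "separated_quotient S A"
  define A' where "A' = insert (\<lambda>_. 0) A"
  have A': "countable A'" "A' \<noteq> {}"
    using assms by (auto simp: A'_def)
  have "embedding_map ?Q ?M (\<lambda>y n. from_nat_into A' n y)"
  proof (rule embedding_map_separated_quotient)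
    have "continuous_map ?Q euclideanreal (from_nat_into A' n)" for n
      using from_nat_into [OF A'(2), of n] unfolding A'_def
      by (auto intro: continuous_map_separated_quotient)
    then show "continuous_map ?Q ?M (\<lambda>y n. from_nat_into A' n y)"
      by (simp add: continuous_map_componentwise_UNIV)
    fix f assume "f \<in> A"
    then obtain n where n: "from_nat_into A' n = f"
      using from_nat_into_surj [OF A'(1), of f] unfolding A'_def by blast
    then show "\<exists>g. continuous_map ?M euclideanreal g \<and>
            (\<forall>x\<in>topspace ?Q. g (\<lambda>n. from_nat_into A' n x) = f x)"
      by (intro exI [of _ "\<lambda>h. h n"] conjI continuous_map_product_projection) auto
  qed
  then obtain T where T: "?Q homeomorphic_space subtopology ?M T"
    using embedding_map_imp_homeomorphic_space by blast
  show "metrizable_space ?Q"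
    using T metrizable_second_countable_real_sequences(1)
    by (meson homeomorphic_metrizable_space metrizable_space_subtopology)
  show "separable_space ?Q"
    using T metrizable_second_countable_real_sequences(2)
    by (meson homeomorphic_space_second_countability second_countable_subtopology
        second_countable_imp_separable_space)
qed

text \<open>Open and closed sets of the initial topology are saturated, so interiors and closures can be
  computed before passing to representatives.\<close>
lemma skeletal_map_representative:
  assumes cont: "\<And>f. f \<in> A \<Longrightarrow> continuous_map X euclideanreal f"
    and near: "\<And>U x. \<lbrakk>openin X U; x \<in> U\<rbrakk> \<Longrightarrow>
      \<exists>V. openin (initial_topology (topspace X) A) V \<and> x \<in> V \<and>
          V \<subseteq> initial_topology (topspace X) A closure_of U"
  shows "skeletal_map X (separated_quotient (topspace X) A) (representative (topspace X) A)"
  unfolding skeletal_map_def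
proof (intro conjI allI impI)
  let ?I = "initial_topology (topspace X) A" and ?Q = "separated_quotient (topspace X) A"
    and ?r = "representative (topspace X) A"
  show "continuous_map X ?Q ?r"
    using cont by (intro continuous_map_representative) auto
  fix U assume "openin X U \<and> U \<noteq> {}"
  then obtain x where U: "openin X U" "x \<in> U" by blast
  then obtain V where V: "openin ?I V" "x \<in> V" "V \<subseteq> ?I closure_of U"
    using near by blast
  have UX: "U \<subseteq> topspace X"
    using U(1) by (rule openin_subset)
  let ?R = "?r ` topspace X"
  have "openin ?Q (V \<inter> ?R)"
    using V(1) unfolding separated_quotient_def openin_subtopology by blast
  moreover have "?r x \<in> V \<inter> ?R"
    using openin_initial_topology_saturated [OF V(1,2), of "?r x"] U UX
    by (auto simp: representative_in representative_eq)
  moreover have "V \<inter> ?R \<subseteq> ?Q closure_of (?r ` U)"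
  proof
    fix z assume z: "z \<in> V \<inter> ?R"
    have "z \<in> ?I closure_of (?r ` U)"
      unfolding in_closure_of
    proof (intro conjI allI impI)
      show "z \<in> topspace ?I"
        using z by (auto simp: representative_in)
      fix N assume "z \<in> N \<and> openin ?I N"
      then obtain u where u: "u \<in> U" "u \<in> N" "openin ?I N"
        using z V(3) unfolding in_closure_of by (meson IntD1 in_closure_of subsetD)
      then have "?r u \<in> N"
        using openin_initial_topology_saturated [of "topspace X" A N u "?r u"] UX
        by (auto simp: representative_in representative_eq)
      then show "\<exists>y. y \<in> ?r ` U \<and> y \<in> N"
        using u(1) by blast
    qed
    moreover have "?R \<inter> ?r ` U = ?r ` U"
      using UX by blast
    ultimately show "z \<in> ?Q closure_of (?r ` U)"
      using z by (simp add: separated_quotient_def closure_of_subtopology)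
  qed
  ultimately show "?Q interior_of (?Q closure_of (?r ` U)) \<noteq> {}"
    using interior_of_maximal by blast
qed

section \<open>Inverse systems of separated quotients\<close>

lemma continuous_map_inverse_limit:
  assumes "\<And>\<alpha>. \<alpha> \<in> I \<Longrightarrow> continuous_map Y (Xs \<alpha>) (\<lambda>y. h y \<alpha>)"
    and "\<And>y. y \<in> topspace Y \<Longrightarrow> h y \<in> extensional I"
    and "\<And>y \<alpha> \<beta>. \<lbrakk>y \<in> topspace Y; \<beta> \<in> I; \<alpha> \<in> I; \<alpha> \<in> underS r \<beta>\<rbrakk> \<Longrightarrow> p \<alpha> \<beta> (h y \<beta>) = h y \<alpha>"
  shows "continuous_map Y (inverse_limit r I Xs p) h"
  unfolding inverse_limit_def continuous_map_in_subtopology continuous_map_componentwise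
  using assms by auto

lemma topspace_inverse_limit:
  "z \<in> topspace (inverse_limit r I Xs p) \<longleftrightarrow>
     z \<in> extensional I \<and> (\<forall>\<alpha>\<in>I. z \<alpha> \<in> topspace (Xs \<alpha>)) \<and>
     (\<forall>\<beta>\<in>I. \<forall>\<alpha>\<in>underS r \<beta> \<inter> I. p \<alpha> \<beta> (z \<beta>) = z \<alpha>)"
  by (auto simp: inverse_limit_def PiE_iff)

lemma continuous_map_inverse_limit_projection:
  "\<alpha> \<in> I \<Longrightarrow> continuous_map (inverse_limit r I Xs p) (Xs \<alpha>) (\<lambda>z. z \<alpha>)"
  unfolding inverse_limit_def
  by (intro continuous_map_from_subtopology continuous_map_product_projection)

lemma underS_transitive:
  "\<lbrakk>trans r; antisym r; a \<in> underS r b; b \<in> underS r c\<rbrakk> \<Longrightarrow> a \<in> underS r c"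
  unfolding underS_def by (auto dest: transD antisymD)

text \<open>A basic open set of a product restricts finitely many coordinates; in an inverse limit over a
  linear order, the largest of them determines the others.\<close>
lemma linear_order_finite_upper_bound:
  assumes "Linear_order r" "finite F" "F \<subseteq> I" "I \<subseteq> Field r" "I \<noteq> {}"
  shows "\<exists>\<beta>\<in>I. \<forall>\<alpha>\<in>F. \<alpha> = \<beta> \<or> \<alpha> \<in> underS r \<beta>"
  using assms(2,3)
proof (induction F rule: finite_induct)
  case empty
  then show ?case using assms(5) by auto
next
  case (insert a F)
  then obtain b where b: "b \<in> I" "\<forall>\<alpha>\<in>F. \<alpha> = b \<or> \<alpha> \<in> underS r b" by auto
  have lin: "trans r" "antisym r" "total_on (Field r) r"
    using assms(1) by (auto simp: order_on_defs)
  consider "a = b" | "a \<in> underS r b" | "b \<in> underS r a"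
    using lin(3) b(1) insert.prems assms(4) unfolding total_on_def underS_def by blast
  then show ?case
  proof cases
    case 3
    have "\<alpha> \<in> underS r a" if "\<alpha> \<in> F" for \<alpha>
      using b(2) that 3 underS_transitive [OF lin(1,2) _ 3] by metis
    then show ?thesis using insert.prems by auto
  qed (use b in auto)
qed

text \<open>The projection from \<open>X\<close> to an earlier space of a system is the composition of the projection to a
  later one with the bonding map. So the bonding maps inherit skeletality, and likewise openness, from
  the projections.\<close>
lemma skeletal_map_cancel:
  assumes h: "continuous_map X Y h" "h ` topspace X = topspace Y"
    and g: "continuous_map Y Z g" and gh: "\<And>x. x \<in> topspace X \<Longrightarrow> g (h x) = f x"
    and f: "skeletal_map X Z f"
  shows "skeletal_map Y Z g"
  unfolding skeletal_map_def
proof (intro conjI allI impI g)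
  fix U assume U: "openin Y U \<and> U \<noteq> {}"
  let ?U = "{x \<in> topspace X. h x \<in> U}"
  have "openin X ?U"
    using openin_continuous_map_preimage [OF h(1)] U by blast
  moreover have hU: "h ` ?U = U"
    using h(2) U openin_subset by fastforce
  then have "?U \<noteq> {}"
    using U by blast
  moreover have "f ` ?U = g ` U"
  proof -
    have "f ` ?U = (\<lambda>x. g (h x)) ` ?U"
      using gh by (intro image_cong) auto
    then show ?thesis
      using hU by (metis image_image)
  qed
  ultimately show "Z interior_of (Z closure_of (g ` U)) \<noteq> {}"
    using f unfolding skeletal_map_def by metis
qed

lemma open_map_cancel:
  assumes h: "continuous_map X Y h" "h ` topspace X = topspace Y"
    and gh: "\<And>x. x \<in> topspace X \<Longrightarrow> g (h x) = f x" and f: "open_map X Z f"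
  shows "open_map Y Z g"
  unfolding open_map_def
proof (intro allI impI)
  fix U assume U: "openin Y U"
  let ?U = "{x \<in> topspace X. h x \<in> U}"
  have "h ` ?U = h ` topspace X \<inter> U"
    by auto
  then have "h ` ?U = U"
    using openin_subset [OF U] by (simp add: h(2) Int_absorb1)
  moreover have "f ` ?U = (\<lambda>x. g (h x)) ` ?U"
    using gh by (intro image_cong) auto
  ultimately have "f ` ?U = g ` U"
    by (metis image_image)
  then show "openin Z (g ` U)"
    using f openin_continuous_map_preimage [OF h(1) U] unfolding open_map_def by metis
qed

text \<open>The family at index \<open>\<alpha>\<close> consists of \<open>B\<close> and of the \<open>S j\<close> whose positions \<open>i j\<close> lie strictly below
  \<open>\<alpha>\<close>, so that it is continuous at limits. The cardinality assumption places all positions below a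
  single index \<open>lam\<close>. From there on the quotient is \<open>X\<close>, the points of the limit are determined by
  their coordinate at \<open>lam\<close>, and functions on the limit factor through that coordinate.\<close>
theorem dugundji_wrt_separated_quotients:
  includes cardinal_syntax
  fixes X :: "'a topology" and B :: "('a \<Rightarrow> real) set" and S :: "'j \<Rightarrow> ('a \<Rightarrow> real) set"
  assumes "Hausdorff_space X"
    and generates: "initial_topology (topspace X) (B \<union> (\<Union>j. S j)) = X"
    and countable: "countable B" "\<And>j. countable (S j)"
    and index: "|UNIV :: 'j set| <o |UNIV :: 'a set set set|"
    and good: "\<And>J. let A = B \<union> (\<Union>j\<in>J. S j) in
                 Q X (separated_quotient (topspace X) A) (representative (topspace X) A)"
    and cancel: "\<And>Y Z f g h. \<lbrakk>continuous_map X Y h; h ` topspace X = topspace Y;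
                   continuous_map Y Z g; \<And>x. x \<in> topspace X \<Longrightarrow> g (h x) = f x; Q X Z f\<rbrakk>
                   \<Longrightarrow> Q Y Z g"
  shows "dugundji_wrt Q X"
proof -
  define r where "r = |UNIV :: 'a set set set|"
  have r: "Card_order r" "Field r = UNIV"
    unfolding r_def by (rule card_of_Card_order) (rule Field_card_of)
  then have wo: "Well_order r"
    unfolding card_order_on_def by simp
  then have lin: "Linear_order r"
    by (simp add: well_order_on_def)
  have ord: "trans r" "antisym r" "total_on (Field r) r" "refl_on (Field r) r"
    using lin by (auto simp: order_on_defs)
  obtain lam where "|UNIV :: 'j set| =o Restr r (underS r lam)"
    using index ordLess_iff_ordIso_Restr [OF wo, of "|UNIV :: 'j set|"] card_of_Well_order
    unfolding r_def by blast
  then obtain i where "bij_betw i (Field |UNIV :: 'j set| ) (Field (Restr r (underS r lam)))"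
    unfolding ordIso_def BNF_Wellorder_Embedding.iso_def by auto
  then have i: "inj i" "\<And>j. i j \<in> underS r lam"
    unfolding bij_betw_def Field_card_of by (auto simp: Field_def)
  define E where "E = topspace X"
  define T where "T = B \<union> (\<Union>j. S j)"
  define A where "A \<alpha> = B \<union> (\<Union>j\<in>{j. i j \<in> underS r \<alpha>}. S j)" for \<alpha>
  define Xs where "Xs \<alpha> = separated_quotient E (A \<alpha>)" for \<alpha>
  define rp where "rp \<alpha> = representative E (A \<alpha>)" for \<alpha>
  define p where "p \<alpha> (\<beta> :: 'a set set) = rp \<alpha>" for \<alpha> \<beta>
  have mono: "A \<alpha> \<subseteq> A \<beta>" if "\<alpha> \<in> underS r \<beta>" for \<alpha> \<beta>
    using underS_transitive [OF ord(1,2) _ that] unfolding A_def by blast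
  have A_T: "A \<alpha> \<subseteq> T" for \<alpha>
    by (auto simp: A_def T_def)
  have A_lam: "A lam = T"
    using i by (auto simp: A_def T_def)
  have A_above: "A \<alpha> = T" if "lam \<in> underS r \<alpha>" for \<alpha>
    using mono [OF that] A_T A_lam by blast
  have gen: "initial_topology E T = X"
    unfolding E_def T_def by (rule generates)
  have sep: "x = y" if xy: "x \<in> E" "y \<in> E" "\<forall>f\<in>T. f x = f y" for x y
  proof (rule ccontr)
    assume "x \<noteq> y"
    then obtain U V where UV: "openin X U" "openin X V" "x \<in> U" "y \<in> V" "disjnt U V"
      using \<open>Hausdorff_space X\<close> xy(1,2) unfolding Hausdorff_space_def E_def by metis
    have "y \<in> U"
      by (rule openin_initial_topology_saturated [of E T U x]) (use UV(1,3) xy gen in auto)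
    then show False
      using UV by (auto simp: disjnt_iff)
  qed
  have rpT: "representative E T x = x" if "x \<in> E" for x
    by (rule representative_separating [OF sep that])
  have X_eq: "separated_quotient E T = X"
    unfolding separated_quotient_def gen using rpT by (simp add: E_def)
  have top: "topspace (Xs \<alpha>) = rp \<alpha> ` E" for \<alpha>
    by (simp add: Xs_def rp_def)
  have topE: "x \<in> E" if "x \<in> topspace (Xs \<alpha>)" for x \<alpha>
    using that unfolding Xs_def by (rule separated_quotient_in)
  have rp_in: "rp \<alpha> x \<in> topspace (Xs \<alpha>)" if "x \<in> E" for x \<alpha>
    using that by (simp add: top)
  have rp_rp: "rp \<alpha> (rp \<beta> x) = rp \<alpha> x" if "x \<in> E" "\<alpha> \<in> underS r \<beta>" for x \<alpha> \<beta>
    unfolding rp_def by (rule representative_representative [OF that(1) mono [OF that(2)]])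
  have rp_fixed: "rp \<alpha> x = x" if "x \<in> topspace (Xs \<alpha>)" for x \<alpha>
    using that unfolding rp_def Xs_def by (rule representative_fixed)
  have cont_p: "continuous_map (Xs \<beta>) (Xs \<alpha>) (rp \<alpha>)" if "\<alpha> \<in> underS r \<beta>" for \<alpha> \<beta>
    unfolding Xs_def rp_def by (rule continuous_map_representative_mono [OF mono [OF that]])
  have contX: "continuous_map X (Xs \<alpha>) (rp \<alpha>)" for \<alpha>
    using continuous_map_representative_mono [OF A_T, of E \<alpha>] unfolding X_eq Xs_def rp_def .
  have Q: "Q (Xs \<beta>) (Xs \<alpha>) (p \<alpha> \<beta>)" if "\<alpha> \<in> underS r \<beta>" for \<alpha> \<beta>
  proof (rule cancel [of "Xs \<beta>" "rp \<beta>" "Xs \<alpha>" _ "rp \<alpha>"])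
    show "Q X (Xs \<alpha>) (rp \<alpha>)"
      using good [of "{j. i j \<in> underS r \<alpha>}"] unfolding Let_def Xs_def rp_def A_def E_def .
  qed (use contX cont_p [OF that] rp_rp that top in \<open>auto simp: p_def E_def\<close>)

  have "inverse_system r Xs p"
    unfolding inverse_system_def
    by (auto simp: p_def cont_p rp_rp topE tychonoff_space_separated_quotient Xs_def [symmetric])
      (simp add: Xs_def tychonoff_space_separated_quotient)
  moreover have "p \<alpha> \<beta> ` topspace (Xs \<beta>) = topspace (Xs \<alpha>)" if "\<alpha> \<in> underS r \<beta>" for \<alpha> \<beta>
    unfolding top p_def image_image using rp_rp [OF _ that] by auto
  moreover have "metrizable_space (Xs \<alpha>) \<and> separable_space (Xs \<alpha>)" if "underS r \<alpha> = {}" for \<alpha>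
    using that countable(1) metrizable_separable_separated_quotient [of B E]
    by (simp add: Xs_def A_def)
  moreover have "metrizable_kernel (Xs \<beta>) (Xs \<alpha>) (p \<alpha> \<beta>)" if "is_successor r \<alpha> \<beta>" for \<alpha> \<beta>
  proof -
    have "underS r \<beta> = insert \<alpha> (underS r \<alpha>)"
      using that ord(4) unfolding is_successor_def under_def underS_def refl_on_def by auto
    \<comment> \<open>At most one \<open>S j\<close> is added, because \<open>i\<close> is injective.\<close>
    then have "A \<beta> = A \<alpha> \<union> (\<Union>j\<in>{j. i j = \<alpha>}. S j)"
      by (auto simp: A_def)
    moreover have "countable {j. i j = \<alpha>}"
    proof (cases "\<exists>j. i j = \<alpha>")
      case True
      then obtain j where "i j = \<alpha>" by blast
      then have "{j. i j = \<alpha>} = {j}"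
        using i(1) by (auto dest: injD)
      then show ?thesis by simp
    qed simp
    then have "countable (\<Union>j\<in>{j. i j = \<alpha>}. S j)"
      using countable(2) by blast
    ultimately show ?thesis
      unfolding Xs_def p_def rp_def by (simp add: metrizable_kernel_separated_quotient)
  qed
  moreover have "embedding_map (Xs \<gamma>) (inverse_limit r (underS r \<gamma>) Xs p) (\<lambda>x. \<lambda>\<alpha>\<in>underS r \<gamma>. p \<alpha> \<gamma> x)"
    if lim: "is_limit r \<gamma>" for \<gamma>
    unfolding Xs_def [of \<gamma>]
  proof (rule embedding_map_separated_quotient, fold Xs_def)
    let ?I = "underS r \<gamma>" and ?j = "\<lambda>x. \<lambda>\<alpha>\<in>underS r \<gamma>. p \<alpha> \<gamma> x"
    show "continuous_map (Xs \<gamma>) (inverse_limit r ?I Xs p) ?j"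
      by (rule continuous_map_inverse_limit) (auto simp: p_def cont_p rp_rp topE)
    fix f assume "f \<in> A \<gamma>"
    \<comment> \<open>Since \<open>\<gamma>\<close> has no predecessor, the family at \<open>\<gamma>\<close> is the union of the earlier ones.\<close>
    moreover have "\<exists>\<beta>\<in>?I. \<alpha> \<in> underS r \<beta>" if "\<alpha> \<in> ?I" for \<alpha>
    proof (rule ccontr)
      assume "\<not> ?thesis"
      then have "\<beta> \<in> under r \<alpha>" if "\<beta> \<in> ?I" for \<beta>
        using that ord(3,4) r(2) unfolding underS_def under_def total_on_def refl_on_def
        by (cases "\<beta> = \<alpha>") auto
      moreover have "\<beta> \<in> ?I" if "\<beta> \<in> under r \<alpha>" for \<beta>
      proof (cases "\<beta> = \<alpha>")
        case False
        then have "\<beta> \<in> underS r \<alpha>"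
          using that by (simp add: under_def underS_def)
        then show ?thesis
          by (rule underS_transitive [OF ord(1,2) _ \<open>\<alpha> \<in> ?I\<close>])
      qed (use \<open>\<alpha> \<in> ?I\<close> in simp)
      ultimately have "underS r \<gamma> = under r \<alpha>"
        by blast
      then show False
        using lim r(2) unfolding is_limit_def is_successor_def by auto
    qed
    moreover have "?I \<noteq> {}"
      using lim by (simp add: is_limit_def)
    ultimately obtain \<beta> where \<beta>: "\<beta> \<in> ?I" "f \<in> A \<beta>"
      unfolding A_def by blast
    have "continuous_map (inverse_limit r ?I Xs p) euclideanreal (f \<circ> (\<lambda>z. z \<beta>))"
      using \<beta>(2) unfolding Xs_def
      by (intro continuous_map_compose [OF continuous_map_inverse_limit_projection [OF \<beta>(1)]]
          continuous_map_separated_quotient)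
    moreover have "(f \<circ> (\<lambda>z. z \<beta>)) (?j x) = f x" if "x \<in> topspace (Xs \<gamma>)" for x
      using \<beta> topE [OF that] by (simp add: p_def rp_def representative_eq)
    ultimately show "\<exists>g. continuous_map (inverse_limit r ?I Xs p) euclideanreal g \<and>
            (\<forall>x\<in>topspace (Xs \<gamma>). g (?j x) = f x)"
      by blast
  qed
  moreover have "dense_in (inverse_limit r (underS r \<gamma>) Xs p)
      ((\<lambda>x. \<lambda>\<alpha>\<in>underS r \<gamma>. p \<alpha> \<gamma> x) ` topspace (Xs \<gamma>))"
    if lim: "is_limit r \<gamma>" for \<gamma>
  proof -
    let ?I = "underS r \<gamma>" and ?j = "\<lambda>x. \<lambda>\<alpha>\<in>underS r \<gamma>. p \<alpha> \<gamma> x"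
    let ?L = "inverse_limit r ?I Xs p"
    have sub: "?j ` topspace (Xs \<gamma>) \<subseteq> topspace ?L"
      by (auto simp: topspace_inverse_limit p_def rp_in rp_rp topE)
    have "z \<in> ?L closure_of (?j ` topspace (Xs \<gamma>))" if z: "z \<in> topspace ?L" for z
      unfolding in_closure_of
    proof (intro conjI allI impI z)
      fix U assume "z \<in> U \<and> openin ?L U"
      then obtain V where V: "openin (product_topology Xs ?I) V" "z \<in> V"
          "V \<inter> {x. \<forall>\<beta>\<in>?I. \<forall>\<alpha>\<in>underS r \<beta> \<inter> ?I. p \<alpha> \<beta> (x \<beta>) = x \<alpha>} = U"
        unfolding inverse_limit_def openin_subtopology by auto
      then obtain W where W: "finite {\<alpha> \<in> ?I. W \<alpha> \<noteq> topspace (Xs \<alpha>)}"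
          "\<forall>\<alpha>\<in>?I. openin (Xs \<alpha>) (W \<alpha>)" "z \<in> PiE ?I W" "PiE ?I W \<subseteq> V"
        unfolding openin_product_topology_alt by meson
      obtain \<beta> where \<beta>: "\<beta> \<in> ?I"
          "\<forall>\<alpha>\<in>{\<alpha> \<in> ?I. W \<alpha> \<noteq> topspace (Xs \<alpha>)}. \<alpha> = \<beta> \<or> \<alpha> \<in> underS r \<beta>"
        using linear_order_finite_upper_bound [OF lin W(1), of ?I] lim r(2)
        unfolding is_limit_def by auto
      \<comment> \<open>The point \<open>z \<beta>\<close> also lies in \<open>X\<close>; its image in the quotient at \<open>\<gamma>\<close> agrees with \<open>z\<close> up to \<open>\<beta>\<close>.\<close>
      define y where "y = rp \<gamma> (z \<beta>)"
      have zE: "z \<beta> \<in> E"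
        using z \<beta>(1) topE by (auto simp: topspace_inverse_limit)
      have y: "y \<in> topspace (Xs \<gamma>)"
        using zE by (simp add: y_def rp_in)
      have "?j y \<alpha> = z \<alpha>" if "\<alpha> \<in> ?I" "\<alpha> = \<beta> \<or> \<alpha> \<in> underS r \<beta>" for \<alpha>
        using that z \<beta>(1) zE rp_rp [OF zE, of \<alpha> \<gamma>] rp_fixed
        by (auto simp: y_def p_def topspace_inverse_limit)
      then have "?j y \<alpha> \<in> W \<alpha>" if "\<alpha> \<in> ?I" for \<alpha>
        using that \<beta>(2) W(3) zE
        by (cases "W \<alpha> = topspace (Xs \<alpha>)") (auto simp: p_def rp_in [OF topE [OF y]])
      then have "?j y \<in> V"
        using W(4) by (auto simp: PiE_iff subset_iff)
      moreover have "?j y \<in> topspace ?L"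
        using sub y by blast
      then have "?j y \<in> {x. \<forall>\<beta>\<in>?I. \<forall>\<alpha>\<in>underS r \<beta> \<inter> ?I. p \<alpha> \<beta> (x \<beta>) = x \<alpha>}"
        unfolding topspace_inverse_limit by simp
      ultimately have "?j y \<in> U"
        using V(3) by blast
      then show "\<exists>y. y \<in> ?j ` topspace (Xs \<gamma>) \<and> y \<in> U"
        using y by blast
    qed
    then show ?thesis
      unfolding dense_in_def using sub closure_of_subset_topspace by (metis subsetI subset_antisym)
  qed
  moreover have "\<exists>e. embedding_map X (inverse_limit r (Field r) Xs p) e \<and>
      (\<forall>\<alpha>\<in>Field r. (\<lambda>x. e x \<alpha>) ` topspace X = topspace (Xs \<alpha>)) \<and>
      (\<forall>f. continuous_map (inverse_limit r (Field r) Xs p) euclideanreal f \<longrightarrow>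
        (\<exists>\<alpha>\<in>Field r. \<exists>g. continuous_map (Xs \<alpha>) euclideanreal g \<and>
           (\<forall>x\<in>topspace (inverse_limit r (Field r) Xs p). f x = g (x \<alpha>))))"
  proof -
    let ?L = "inverse_limit r (Field r) Xs p"
    define e where "e = (\<lambda>x \<alpha>. rp \<alpha> x)"
    have cont: "continuous_map X ?L e"
      by (rule continuous_map_inverse_limit) (auto simp: r(2) e_def contX p_def rp_rp E_def)
    have "embedding_map (separated_quotient E T) ?L e"
    proof (rule embedding_map_separated_quotient)
      show "continuous_map (separated_quotient E T) ?L e"
        unfolding X_eq by (rule cont)
      fix f assume f: "f \<in> T"
      then have "continuous_map (Xs lam) euclideanreal f"
        unfolding Xs_def A_lam by (rule continuous_map_separated_quotient)
      then have "continuous_map ?L euclideanreal (f \<circ> (\<lambda>z. z lam))"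
        by (intro continuous_map_compose [OF continuous_map_inverse_limit_projection]) (simp_all add: r(2))
      moreover have "(f \<circ> (\<lambda>z. z lam)) (e x) = f x" if "x \<in> topspace (separated_quotient E T)" for x
        using f separated_quotient_in [OF that] by (simp add: e_def rp_def A_lam representative_eq)
      ultimately show "\<exists>g. continuous_map ?L euclideanreal g \<and>
          (\<forall>x\<in>topspace (separated_quotient E T). g (e x) = f x)"
        by blast
    qed
    then have emb: "embedding_map X ?L e"
      by (simp only: X_eq)
    have e_lam: "e (z lam) = z" if z: "z \<in> topspace ?L" for z
    proof
      fix \<alpha>
      have zE: "z \<alpha> \<in> E" for \<alpha>
        using z topE by (auto simp: topspace_inverse_limit r(2))
      consider "\<alpha> = lam" | "\<alpha> \<in> underS r lam" | "lam \<in> underS r \<alpha>"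
        using ord(3) r(2) unfolding total_on_def underS_def by blast
      then show "e (z lam) \<alpha> = z \<alpha>"
      proof cases
        case 3
        then have "rp lam (z \<alpha>) = z lam"
          using z by (auto simp: topspace_inverse_limit r(2) p_def)
        then show ?thesis
          using zE rpT by (simp add: e_def rp_def A_lam A_above [OF 3])
      qed (use z zE rpT in \<open>auto simp: e_def topspace_inverse_limit r(2) p_def rp_def A_lam\<close>)
    qed
    have "\<exists>\<alpha>\<in>Field r. \<exists>g. continuous_map (Xs \<alpha>) euclideanreal g \<and> (\<forall>x\<in>topspace ?L. f x = g (x \<alpha>))"
      if f: "continuous_map ?L euclideanreal f" for f
    proof (intro bexI exI conjI ballI)
      show "continuous_map (Xs lam) euclideanreal (f \<circ> e)"
        unfolding Xs_def A_lam X_eq by (rule continuous_map_compose [OF cont f])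
      show "f x = (f \<circ> e) (x lam)" if "x \<in> topspace ?L" for x
        using e_lam [OF that] by simp
    qed (simp add: r(2))
    moreover have "(\<lambda>x. e x \<alpha>) ` topspace X = topspace (Xs \<alpha>)" for \<alpha>
      by (simp add: e_def top E_def)
    ultimately show ?thesis
      using emb by blast
  qed
  ultimately show ?thesis
    unfolding dugundji_wrt_def Let_def using r Q
    by (intro exI [of _ r] exI [of _ Xs] exI [of _ p]) auto
qed

text \<open>The topology of \<open>X\<close> is generated by functions indexed by pairs of a point and an open
  neighbourhood. The strict inequality, also for finite types, leaves room for all these indices below a single
  index of the system.\<close>
lemma card_points_and_subsets:
  includes cardinal_syntax
  shows "|UNIV :: ('a \<times> 'a set) set| <o |UNIV :: 'a set set set|"
proof (cases "finite (UNIV :: 'a set)")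
  case True
  define k where "k = card (UNIV :: 'a set)"
  have "k > 0"
    using True by (simp add: k_def card_gt_0_iff)
  then obtain l where l: "k = Suc l"
    using gr0_implies_Suc by blast
  have "Suc l \<le> 2 ^ l"
    using less_exp [of l] by (rule Suc_leI)
  then have "2 * k \<le> 2 ^ k"
    unfolding l power_Suc by (rule mult_le_mono2)
  have "k * 2 ^ k < 2 ^ k * (2 ^ k :: nat)"
    by (simp add: less_exp)
  also have "\<dots> = 2 ^ (2 * k)"
    by (simp add: power_add [symmetric] mult_2)
  also have "\<dots> \<le> 2 ^ (2 ^ k)"
    using \<open>2 * k \<le> 2 ^ k\<close> by (intro power_increasing) simp_all
  finally have lt: "k * 2 ^ k < (2 :: nat) ^ (2 ^ k)" .
  have "card (UNIV :: ('a \<times> 'a set) set) = k * 2 ^ k"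
    using True by (simp add: k_def card_cartesian_product card_Pow
        flip: UNIV_Times_UNIV Pow_UNIV)
  moreover have "card (UNIV :: 'a set set set) = 2 ^ (2 ^ k)"
    using True by (simp add: k_def card_Pow flip: Pow_UNIV)
  ultimately have less: "card (UNIV :: ('a \<times> 'a set) set) < card (UNIV :: 'a set set set)"
    using lt by simp
  have "\<not> |UNIV :: 'a set set set| \<le>o |UNIV :: ('a \<times> 'a set) set|"
  proof
    assume "|UNIV :: 'a set set set| \<le>o |UNIV :: ('a \<times> 'a set) set|"
    then obtain f :: "'a set set \<Rightarrow> 'a \<times> 'a set" where "inj f"
      unfolding card_of_ordLeq [symmetric] by blast
    moreover have "finite (UNIV :: ('a \<times> 'a set) set)"
      using True by (simp add: finite_prod Finite_Set.finite_set)
    ultimately show False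
      using card_inj_on_le [of f UNIV UNIV] less by simp
  qed
  then show ?thesis
    by (rule iffD1 [OF not_ordLeq_iff_ordLess [OF card_of_Well_order card_of_Well_order]])
next
  case False
  have inf: "\<not> finite (UNIV :: 'a set set)"
    using False by (simp add: Finite_Set.finite_set)
  have "|UNIV :: 'a set| <o |Pow (UNIV :: 'a set)|"
    by (rule card_of_Pow)
  then have "|UNIV :: 'a set| \<le>o |UNIV :: 'a set set|"
    by (simp add: ordLess_imp_ordLeq)
  then have "|(UNIV :: 'a set) \<times> (UNIV :: 'a set set)| =o |UNIV :: 'a set set|"
    using card_of_Times_infinite [OF inf] by blast
  moreover have "|UNIV :: 'a set set| <o |UNIV :: 'a set set set|"
    using card_of_Pow [of "UNIV :: 'a set set"] by simp
  ultimately show ?thesis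
    using ordIso_ordLess_trans by simp
qed

section \<open>Cech-complete spaces in their compactifications\<close>

lemma unit_functions_continuous:
  "f \<in> unit_functions Y \<Longrightarrow> continuous_map Y euclideanreal f"
  by (auto simp: unit_functions_def continuous_map_in_subtopology)

lemma compact_space_stone_cech: "compact_space (stone_cech Y)"
proof -
  let ?Q = "product_topology (\<lambda>_. top_of_set {0..1::real}) (unit_functions Y)"
  have "compact_space ?Q"
    by (simp add: compact_space_product_topology compact_space_subtopology)
  then show ?thesis
    unfolding stone_cech_def Let_def
    by (intro compact_space_subtopology closedin_compact_space) auto
qed

lemma continuous_map_stone_cech_coordinate:
  assumes "f \<in> unit_functions Y"
  shows "continuous_map (stone_cech Y) euclideanreal (\<lambda>z. z f)"
proof -
  have "continuous_map (stone_cech Y) (top_of_set {0..1}) (\<lambda>z. z f)"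
    unfolding stone_cech_def Let_def
    by (intro continuous_map_from_subtopology continuous_map_product_projection assms)
  then show ?thesis
    by (simp add: continuous_map_in_subtopology)
qed

lemma stone_cech_map_cube:
  "stone_cech_map Y ` topspace Y
     \<subseteq> topspace (product_topology (\<lambda>_. top_of_set {0..1::real}) (unit_functions Y))"
proof -
  have "f y \<in> {0..1}" if "f \<in> unit_functions Y" "y \<in> topspace Y" for f y
    using that by (auto simp: unit_functions_def continuous_map_in_subtopology Pi_iff)
  then show ?thesis
    by (auto simp: stone_cech_map_def)
qed

lemma topspace_stone_cech:
  "topspace (stone_cech Y) = product_topology (\<lambda>_. top_of_set {0..1::real}) (unit_functions Y)
     closure_of (stone_cech_map Y ` topspace Y)"
  unfolding stone_cech_def Let_def topspace_subtopology
  by (rule Int_absorb1 [OF closure_of_subset_topspace])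

lemma stone_cech_map_in: "y \<in> topspace Y \<Longrightarrow> stone_cech_map Y y \<in> topspace (stone_cech Y)"
  unfolding topspace_stone_cech using closure_of_subset [OF stone_cech_map_cube [of Y]] by (meson image_eqI subsetD)

lemma stone_cech_dense:
  "stone_cech Y closure_of (stone_cech_map Y ` topspace Y) = topspace (stone_cech Y)"
  using closure_of_subset [OF stone_cech_map_cube [of Y]]
  unfolding topspace_stone_cech unfolding stone_cech_def Let_def closure_of_subtopology
  by (simp add: Int_absorb1)

text \<open>The canonical map from the Stone--Cech compactification to \<open>K\<close> sends the remainder of \<open>Y\<close> to the remainder
  of \<open>Y\<close> in \<open>K\<close>, so that the complement of the image of a closed set in the first remainder is
  an open set containing \<open>Y\<close>. Only the graph \<open>\<Gamma>\<close> of that map is needed: it consists of the pairs on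
  which every function of \<open>K\<close> takes the value given by its restriction to \<open>Y\<close>, and it is a compact set
  that projects onto \<open>K\<close>.\<close>
lemma cech_complete_gdelta_in_compactification:
  fixes Y :: "'a topology" and K :: "'k topology"
  assumes comp: "compactification Y K c" and cech: "cech_complete_space Y"
  obtains \<V> where "countable \<V>" "\<And>V. V \<in> \<V> \<Longrightarrow> openin K V"
    "topspace K \<inter> \<Inter>\<V> = c ` topspace Y"
proof -
  have K: "compact_space K" "Hausdorff_space K" and emb: "embedding_map Y K c"
    and dense: "K closure_of (c ` topspace Y) = topspace K"
    using comp by (auto simp: compactification_def dense_in_def)
  have crK: "completely_regular_space K"
    by (intro K compact_imp_locally_compact_space
        locally_compact_regular_imp_completely_regular_space
        compact_Hausdorff_imp_regular_space disjI1)
  have hom: "homeomorphic_map Y (subtopology K (c ` topspace Y)) c"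
    using emb by (simp add: embedding_map_def)
  have contc: "continuous_map Y K c"
    using hom homeomorphic_imp_continuous_map continuous_map_in_subtopology by blast
  have injc: "inj_on c (topspace Y)"
    using hom by (rule homeomorphic_imp_injective_map)
  have cK: "c y \<in> topspace K" if "y \<in> topspace Y" for y
    using contc that by (meson continuous_map_def funcset_mem)
  define \<beta> where "\<beta> = stone_cech Y"
  define \<iota> where "\<iota> = stone_cech_map Y"
  define C where "C = {\<phi>. continuous_map K (top_of_set {0..1::real}) \<phi>}"
  define tr where "tr \<phi> = restrict (\<phi> \<circ> c) (topspace Y)" for \<phi> :: "'k \<Rightarrow> real"
  have tr: "tr \<phi> \<in> unit_functions Y" if "\<phi> \<in> C" for \<phi>
  proof -
    have "continuous_map Y (top_of_set {0..1}) (\<phi> \<circ> c)"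
      using that contc unfolding C_def by (auto intro: continuous_map_compose)
    then have "continuous_map Y (top_of_set {0..1}) (tr \<phi>)"
      by (rule continuous_map_eq) (simp add: tr_def)
    then show ?thesis
      by (simp add: unit_functions_def tr_def)
  qed
  have contC: "continuous_map K euclideanreal \<phi>" if "\<phi> \<in> C" for \<phi>
    using that by (simp add: C_def continuous_map_in_subtopology)
  let ?P = "prod_topology \<beta> K"
  define \<Gamma> where "\<Gamma> = (\<Inter>\<phi>\<in>C. {u \<in> topspace ?P. fst u (tr \<phi>) - \<phi> (snd u) \<in> {0}})"
  have mem\<Gamma>: "(z, k) \<in> \<Gamma> \<longleftrightarrow> z \<in> topspace \<beta> \<and> k \<in> topspace K \<and> (\<forall>\<phi>\<in>C. z (tr \<phi>) = \<phi> k)" for z k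
  proof -
    have "(\<lambda>_. 0) \<in> C"
      by (simp add: C_def)
    then show ?thesis
      unfolding \<Gamma>_def by auto
  qed
  have closed\<Gamma>: "closedin ?P \<Gamma>"
    unfolding \<Gamma>_def
  proof (intro closedin_INT)
    show "C \<noteq> {}"
      by (auto simp: C_def intro!: exI [of _ "\<lambda>_. 0"])
    fix \<phi> assume "\<phi> \<in> C"
    have "continuous_map ?P euclideanreal ((\<lambda>z. z (tr \<phi>)) \<circ> fst)"
      unfolding \<beta>_def
      by (intro continuous_map_compose [OF continuous_map_fst]
          continuous_map_stone_cech_coordinate tr \<open>\<phi> \<in> C\<close>)
    moreover have "continuous_map ?P euclideanreal (\<phi> \<circ> snd)"
      by (intro continuous_map_compose [OF continuous_map_snd] contC \<open>\<phi> \<in> C\<close>)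
    ultimately have "continuous_map ?P euclideanreal (\<lambda>u. fst u (tr \<phi>) - \<phi> (snd u))"
      using continuous_map_diff by (fastforce simp: o_def)
    then show "closedin ?P {u \<in> topspace ?P. fst u (tr \<phi>) - \<phi> (snd u) \<in> {0}}"
      by (rule closedin_continuous_map_preimage) simp
  qed
  have compactP: "compact_space ?P"
    using K(1) compact_space_stone_cech [of Y] by (simp add: \<beta>_def compact_space_prod_topology)
  have closed_image: "closedin K (snd ` (\<Gamma> \<inter> F \<times> topspace K))" if F: "closedin \<beta> F" for F
  proof -
    have "closedin ?P (\<Gamma> \<inter> F \<times> topspace K)"
      using closed\<Gamma> F by (intro closedin_Int) (auto simp: closedin_prod_Times_iff)
    then have "compactin K (snd ` (\<Gamma> \<inter> F \<times> topspace K))"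
      by (intro image_compactin [OF closedin_compact_space [OF compactP]] continuous_map_snd)
    then show ?thesis
      by (rule compactin_imp_closedin [OF K(2)])
  qed
  have \<iota>: "(\<iota> y, c y) \<in> \<Gamma>" if "y \<in> topspace Y" for y
    using that tr unfolding mem\<Gamma> \<beta>_def \<iota>_def
    by (auto simp: stone_cech_map_in cK) (simp add: stone_cech_map_def tr_def)
  have total: "\<exists>z. (z, k) \<in> \<Gamma>" if k: "k \<in> topspace K" for k
  proof -
    have "c ` topspace Y \<subseteq> snd ` (\<Gamma> \<inter> topspace \<beta> \<times> topspace K)"
    proof
      fix x assume "x \<in> c ` topspace Y"
      then obtain y where "y \<in> topspace Y" "x = c y" by blast
      then show "x \<in> snd ` (\<Gamma> \<inter> topspace \<beta> \<times> topspace K)"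
        using \<iota> [of y] mem\<Gamma> by (intro image_eqI [of _ _ "(\<iota> y, c y)"]) auto
    qed
    then have "K closure_of (c ` topspace Y) \<subseteq> snd ` (\<Gamma> \<inter> topspace \<beta> \<times> topspace K)"
      by (rule closure_of_minimal [OF _ closed_image]) simp
    then show ?thesis
      using k unfolding dense by force
  qed
  \<comment> \<open>Remainder goes to remainder: a function \<open>f\<close> that tells \<open>z\<close> from \<open>y\<close> makes \<open>N\<close> a neighbourhood of
    \<open>y\<close> away from \<open>z\<close>, and \<open>N\<close> is the trace of an open set of \<open>K\<close>, hence is seen by some \<open>\<phi>\<close>.\<close>
  have only: "z = \<iota> y" if y: "y \<in> topspace Y" and z\<Gamma>: "(z, c y) \<in> \<Gamma>" for y z
  proof (rule ccontr)
    assume "z \<noteq> \<iota> y"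
    have z: "z \<in> topspace \<beta>" and z_tr: "\<And>\<phi>. \<phi> \<in> C \<Longrightarrow> z (tr \<phi>) = \<phi> (c y)"
      using z\<Gamma> by (auto simp: mem\<Gamma>)
    have "z \<in> extensional (unit_functions Y)"
      using z by (auto simp: \<beta>_def stone_cech_def Let_def PiE_def)
    moreover have "\<iota> y \<in> extensional (unit_functions Y)"
      by (simp add: \<iota>_def stone_cech_map_def)
    ultimately obtain f where f: "f \<in> unit_functions Y" "z f \<noteq> \<iota> y f"
      using \<open>z \<noteq> \<iota> y\<close> by (meson extensionalityI)
    then have ne: "z f \<noteq> f y"
      by (simp add: \<iota>_def stone_cech_map_def)
    define \<delta> where "\<delta> = \<bar>z f - f y\<bar> / 2"
    have "\<delta> > 0"
      using ne by (simp add: \<delta>_def)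
    define N where "N = {y' \<in> topspace Y. \<bar>f y' - f y\<bar> \<in> {..<\<delta>}}"
    have "continuous_map Y euclideanreal (\<lambda>y'. \<bar>f y' - f y\<bar>)"
      by (intro continuous_map_real_abs continuous_map_diff unit_functions_continuous [OF f(1)]) simp
    then have "openin Y N"
      unfolding N_def by (rule openin_continuous_map_preimage) simp
    then have "openin (subtopology K (c ` topspace Y)) (c ` N)"
      using homeomorphic_imp_open_map [OF hom] by (simp add: open_map_def)
    then obtain W where W: "openin K W" "c ` N = W \<inter> c ` topspace Y"
      unfolding openin_subtopology by blast
    have "c y \<in> W"
      using W(2) y \<open>\<delta> > 0\<close> by (auto simp: N_def)
    then have "closedin K (topspace K - W) \<and> c y \<in> topspace K - (topspace K - W)"
      using W(1) cK [OF y] by auto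
    then obtain \<phi> where \<phi>: "\<phi> \<in> C" "\<phi> (c y) = 0" "\<phi> ` (topspace K - W) \<subseteq> {1}"
      using crK unfolding completely_regular_space_def C_def by (metis mem_Collect_eq)
    define M where "M = {z' \<in> topspace \<beta>. z' (tr \<phi>) \<in> {..<1}} \<inter> {z' \<in> topspace \<beta>. \<bar>z' f - z f\<bar> \<in> {..<\<delta>}}"
    have "continuous_map \<beta> euclideanreal (\<lambda>z'. \<bar>z' f - z f\<bar>)"
      unfolding \<beta>_def
      by (intro continuous_map_real_abs continuous_map_diff
          continuous_map_stone_cech_coordinate [OF f(1)]) simp
    moreover have "continuous_map \<beta> euclideanreal (\<lambda>z'. z' (tr \<phi>))"
      unfolding \<beta>_def by (rule continuous_map_stone_cech_coordinate [OF tr [OF \<phi>(1)]])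
    ultimately have "openin \<beta> M"
      unfolding M_def by (intro openin_Int openin_continuous_map_preimage [where Y = euclideanreal]) auto
    moreover have "z \<in> M"
      using z z_tr [OF \<phi>(1)] \<phi>(2) \<open>\<delta> > 0\<close> by (simp add: M_def)
    moreover have "z \<in> \<beta> closure_of (\<iota> ` topspace Y)"
      using z unfolding \<beta>_def \<iota>_def stone_cech_dense by simp
    ultimately obtain y' where y': "y' \<in> topspace Y" "\<iota> y' \<in> M"
      unfolding in_closure_of by auto
    have "\<phi> (c y') < 1" "\<bar>f y' - z f\<bar> < \<delta>"
      using y' f(1) tr [OF \<phi>(1)] by (auto simp: M_def \<iota>_def stone_cech_map_def tr_def)
    then have "c y' \<in> W"
      using \<phi>(3) cK [OF y'(1)] by auto
    then have "c y' \<in> c ` N"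
      using W(2) y'(1) by blast
    then have "y' \<in> N"
      using injc y'(1) by (auto simp: N_def dest: inj_onD)
    then have "\<bar>f y' - f y\<bar> < \<delta>"
      by (simp add: N_def)
    moreover have "\<bar>z f - f y\<bar> \<le> \<bar>f y' - f y\<bar> + \<bar>f y' - z f\<bar>"
      using abs_triangle_ineq4 [of "f y' - f y" "f y' - z f"] by simp
    moreover have "\<bar>z f - f y\<bar> = \<delta> + \<delta>"
      by (simp add: \<delta>_def)
    ultimately show False
      using \<open>\<bar>f y' - z f\<bar> < \<delta>\<close> by linarith
  qed
  obtain \<U> where \<U>: "countable \<U>" "\<And>U. U \<in> \<U> \<Longrightarrow> openin \<beta> U" "\<Inter>\<U> = \<iota> ` topspace Y"
    using cech unfolding cech_complete_space_def gdelta_in_alt intersection_of_def \<beta>_def \<iota>_def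
    by auto
  define V where "V U = topspace K - snd ` (\<Gamma> \<inter> (topspace \<beta> - U) \<times> topspace K)" for U
  show thesis
  proof
    show "countable (V ` \<U>)"
      using \<U>(1) by simp
    show "openin K W" if "W \<in> V ` \<U>" for W
      using that \<U>(2) unfolding V_def by (auto intro!: openin_diff closed_image)
    show "topspace K \<inter> \<Inter>(V ` \<U>) = c ` topspace Y"
    proof (intro equalityI subsetI)
      fix k assume k: "k \<in> topspace K \<inter> \<Inter>(V ` \<U>)"
      then obtain z where z: "(z, k) \<in> \<Gamma>"
        using total by blast
      have "z \<in> U" if "U \<in> \<U>" for U
      proof (rule ccontr)
        assume "z \<notin> U"
        then have "k \<in> snd ` (\<Gamma> \<inter> (topspace \<beta> - U) \<times> topspace K)"
          using z mem\<Gamma> by (intro image_eqI [of _ _ "(z, k)"]) auto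
        moreover have "k \<in> V U"
          using k that by blast
        ultimately show False
          by (simp add: V_def)
      qed
      then have "z \<in> \<iota> ` topspace Y"
        using \<U>(3) by blast
      then obtain y where y: "y \<in> topspace Y" "z = \<iota> y" by blast
      have "k = c y"
      proof (rule ccontr)
        assume "k \<noteq> c y"
        then have "closedin K {k} \<and> c y \<in> topspace K - {k}"
          using k cK [OF y(1)] K(2) by (auto intro: closedin_Hausdorff_singleton)
        then obtain \<phi> where \<phi>: "\<phi> \<in> C" "\<phi> (c y) = 0" "\<phi> ` {k} \<subseteq> {1}"
          using crK unfolding completely_regular_space_def C_def by (metis mem_Collect_eq)
        then show False
          using z \<iota> [OF y(1)] y(2) unfolding mem\<Gamma> by auto
      qed
      then show "k \<in> c ` topspace Y"
        using y by blast
    next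
      fix k assume "k \<in> c ` topspace Y"
      then obtain y where y: "y \<in> topspace Y" "k = c y" by blast
      have "k \<in> V U" if "U \<in> \<U>" for U
      proof -
        have "\<iota> y \<in> U"
          using \<U>(3) that y(1) by blast
        then show ?thesis
          using only [OF y(1)] y cK unfolding V_def by auto
      qed
      then show "k \<in> topspace K \<inter> \<Inter>(V ` \<U>)"
        using y cK by auto
    qed
  qed
qed

section \<open>Omega-narrow groups acting on compact spaces\<close>

locale omega_narrow_compact_action =
  fixes G :: "('g, 'm) monoid_scheme" (structure) and T :: "'g topology"
    and K :: "'k topology" and \<theta> :: "'g \<Rightarrow> 'k \<Rightarrow> 'k"
  assumes group: "group G" and carrier: "topspace T = carrier G"
    and narrow: "omega_narrow G T"
    and action: "continuous_action G T K \<theta>"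
    and compact: "compact_space K"
begin

sublocale group G
  by (rule group)

sublocale group_action G "topspace K" \<theta>
  using action by (simp add: continuous_action_def)

lemma action_in: "\<lbrakk>g \<in> carrier G; x \<in> topspace K\<rbrakk> \<Longrightarrow> \<theta> g x \<in> topspace K"
  using element_image by blast

lemma action_mult:
  "\<lbrakk>g \<in> carrier G; h \<in> carrier G; x \<in> topspace K\<rbrakk> \<Longrightarrow> \<theta> (g \<otimes> h) x = \<theta> g (\<theta> h x)"
  by (rule composition_rule)

lemma action_one: "x \<in> topspace K \<Longrightarrow> \<theta> \<one> x = x"
  using id_eq_one by (metis restrict_apply')

lemma action_inv: "\<lbrakk>g \<in> carrier G; x \<in> topspace K\<rbrakk> \<Longrightarrow> \<theta> (inv g) (\<theta> g x) = x"
  using action_mult [of "inv g" g x] by (simp add: action_one)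

lemma continuous_map_action:
  assumes "g \<in> carrier G"
  shows "continuous_map K K (\<theta> g)"
proof -
  have "continuous_map K (prod_topology T K) (\<lambda>x. (g, x))"
    using assms carrier by (auto simp: continuous_map_pairwise o_def)
  then have "continuous_map K K ((\<lambda>(g, x). \<theta> g x) \<circ> (\<lambda>x. (g, x)))"
    using action unfolding continuous_action_def by (blast intro: continuous_map_compose)
  then show ?thesis
    by (simp add: o_def)
qed

text \<open>These sets are symmetric and satisfy the triangle inequality in \<open>\<epsilon>\<close>. They stand in for the
  neighbourhoods of the neutral element of a topological group.\<close>
definition almost_stabilizer :: "('k \<Rightarrow> real) \<Rightarrow> real \<Rightarrow> 'g set" where
  "almost_stabilizer f \<epsilon> = {g \<in> carrier G. \<forall>x\<in>topspace K. \<bar>f (\<theta> g x) - f x\<bar> \<le> \<epsilon>}"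

text \<open>By compactness of \<open>K\<close>, joint continuity at the points \<open>(\<one>, x)\<close> becomes uniform in \<open>x\<close>.\<close>
lemma almost_stabilizer_neighbourhood:
  assumes f: "continuous_map K euclideanreal f" and "\<epsilon> > 0"
  shows "\<exists>V. openin T V \<and> \<one> \<in> V \<and> V \<subseteq> almost_stabilizer f \<epsilon>"
proof -
  let ?P = "prod_topology T K"
  define W where "W = {u \<in> topspace ?P. \<bar>f ((\<lambda>(g, x). \<theta> g x) u) - f (snd u)\<bar> \<in> {..<\<epsilon>}}"
  have "continuous_map ?P euclideanreal (f \<circ> (\<lambda>(g, x). \<theta> g x))"
    using action f unfolding continuous_action_def by (blast intro: continuous_map_compose)
  moreover have "continuous_map ?P euclideanreal (f \<circ> snd)"
    by (rule continuous_map_compose [OF continuous_map_snd f])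
  ultimately have "continuous_map ?P euclideanreal (\<lambda>u. \<bar>f ((\<lambda>(g, x). \<theta> g x) u) - f (snd u)\<bar>)"
    unfolding o_def by (intro continuous_intros)
  then have "openin ?P W"
    unfolding W_def by (rule openin_continuous_map_preimage) simp
  moreover have "{\<one>} \<times> topspace K \<subseteq> W"
    using carrier \<open>\<epsilon> > 0\<close> by (auto simp: W_def action_one)
  ultimately obtain V V' where V: "openin T V" "\<one> \<in> V" "topspace K \<subseteq> V'" "V \<times> V' \<subseteq> W"
    using tube_lemma_right [of T K W "topspace K" \<one>] compact carrier
    unfolding compact_space_def by auto
  have "V \<subseteq> almost_stabilizer f \<epsilon>"
  proof
    fix g assume "g \<in> V"
    then have "(g, x) \<in> W" if "x \<in> topspace K" for x
      using V that by blast
    then show "g \<in> almost_stabilizer f \<epsilon>"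
      using V(1) \<open>g \<in> V\<close> openin_subset carrier
      by (fastforce simp: almost_stabilizer_def W_def)
  qed
  then show ?thesis
    using V by blast
qed

lemma almost_stabilizer_covers:
  assumes "continuous_map K euclideanreal f" "\<epsilon> > 0"
  shows "\<exists>D. countable D \<and> D \<subseteq> carrier G \<and>
    (\<forall>g\<in>carrier G. \<exists>u\<in>almost_stabilizer f \<epsilon>. \<exists>d\<in>D. g = u \<otimes> d) \<and>
    (\<forall>g\<in>carrier G. \<exists>d\<in>D. \<exists>u\<in>almost_stabilizer f \<epsilon>. g = d \<otimes> u)"
proof -
  have "almost_stabilizer f \<epsilon> \<subseteq> carrier G"
    by (auto simp: almost_stabilizer_def)
  then obtain D where D: "countable D" "D \<subseteq> carrier G"
      "almost_stabilizer f \<epsilon> <#> D = carrier G" "D <#> almost_stabilizer f \<epsilon> = carrier G"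
    using narrow almost_stabilizer_neighbourhood [OF assms] unfolding omega_narrow_def by meson
  have "\<exists>u\<in>almost_stabilizer f \<epsilon>. \<exists>d\<in>D. g = u \<otimes> d" if "g \<in> carrier G" for g
    using that unfolding D(3) [symmetric] by (auto simp: set_mult_def)
  moreover have "\<exists>d\<in>D. \<exists>u\<in>almost_stabilizer f \<epsilon>. g = d \<otimes> u" if "g \<in> carrier G" for g
    using that unfolding D(4) [symmetric] by (auto simp: set_mult_def)
  ultimately show ?thesis
    using D(1,2) by (intro exI [of _ D]) simp
qed

text \<open>If \<open>g = u \<otimes> d\<close> with \<open>u\<close> in the almost stabilizer, then \<open>f \<circ> g\<close> and \<open>f \<circ> d\<close> differ at \<open>x\<close> as much as
  \<open>f \<circ> u\<close> and \<open>f\<close> differ at \<open>d x\<close>. This is why the countable factor has to stand on the right here,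
  whereas covering an orbit by translates needs it on the left.\<close>
lemma exists_countable_orbit_net:
  assumes f: "continuous_map K euclideanreal f"
  shows "\<exists>D. countable D \<and> D \<subseteq> carrier G \<and>
           (\<forall>g\<in>carrier G. \<forall>\<epsilon>>0. \<exists>d\<in>D. \<forall>x\<in>topspace K. \<bar>f (\<theta> g x) - f (\<theta> d x)\<bar> \<le> \<epsilon>)"
proof -
  have "\<exists>D. countable D \<and> D \<subseteq> carrier G \<and>
          (\<forall>g\<in>carrier G. \<exists>u\<in>almost_stabilizer f (1 / Suc n). \<exists>d\<in>D. g = u \<otimes> d)" for n
  proof -
    have "0 < 1 / real (Suc n)"
      by simp
    from almost_stabilizer_covers [OF f this] show ?thesis
      by meson
  qed
  then obtain D where D: "\<And>n. countable (D n)" "\<And>n. D n \<subseteq> carrier G"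
      "\<And>n g. g \<in> carrier G \<Longrightarrow> \<exists>u\<in>almost_stabilizer f (1 / Suc n). \<exists>d\<in>D n. g = u \<otimes> d"
    by metis
  have "\<exists>d\<in>(\<Union>n. D n). \<forall>x\<in>topspace K. \<bar>f (\<theta> g x) - f (\<theta> d x)\<bar> \<le> \<epsilon>"
    if g: "g \<in> carrier G" and "\<epsilon> > 0" for g \<epsilon>
  proof -
    obtain n where n: "1 / Suc n < \<epsilon>"
      using \<open>\<epsilon> > 0\<close> nat_approx_posE by blast
    obtain u d where ud: "u \<in> almost_stabilizer f (1 / Suc n)" "d \<in> D n" "g = u \<otimes> d"
      using D(3) [OF g] by blast
    then have "u \<in> carrier G" "d \<in> carrier G"
      using D(2) by (auto simp: almost_stabilizer_def)
    then have "\<bar>f (\<theta> g x) - f (\<theta> d x)\<bar> \<le> \<epsilon>" if "x \<in> topspace K" for x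
      using ud that n action_in [of d x] unfolding almost_stabilizer_def
      by (fastforce simp: action_mult)
    then show ?thesis
      using ud(2) by blast
  qed
  moreover have "countable (\<Union>n. D n)" "(\<Union>n. D n) \<subseteq> carrier G"
    using D(1,2) by auto
  ultimately show ?thesis
    by (intro exI [of _ "\<Union>n. D n"]) simp
qed

text \<open>The function \<open>f\<close> is inserted explicitly, since \<open>f \<circ> \<theta> \<one>\<close> need not agree with it outside \<open>K\<close>.\<close>
definition orbit_net :: "('k \<Rightarrow> real) \<Rightarrow> ('k \<Rightarrow> real) set" where
  "orbit_net f = insert f ((\<lambda>d. f \<circ> \<theta> d) `
     (SOME D. countable D \<and> D \<subseteq> carrier G \<and>
        (\<forall>g\<in>carrier G. \<forall>\<epsilon>>0. \<exists>d\<in>D. \<forall>x\<in>topspace K. \<bar>f (\<theta> g x) - f (\<theta> d x)\<bar> \<le> \<epsilon>)))"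

lemma orbit_net:
  assumes f: "continuous_map K euclideanreal f"
  shows countable_orbit_net: "countable (orbit_net f)"
    and orbit_net_approximates: "\<lbrakk>g \<in> carrier G; \<epsilon> > 0\<rbrakk> \<Longrightarrow>
          \<exists>h\<in>orbit_net f. \<forall>x\<in>topspace K. \<bar>f (\<theta> g x) - h x\<bar> \<le> \<epsilon>"
    and orbit_net_translate: "h \<in> orbit_net f \<Longrightarrow>
          \<exists>d\<in>carrier G. \<forall>x\<in>topspace K. h x = f (\<theta> d x)"
proof -
  define D where "D = (SOME D. countable D \<and> D \<subseteq> carrier G \<and>
        (\<forall>g\<in>carrier G. \<forall>\<epsilon>>0. \<exists>d\<in>D. \<forall>x\<in>topspace K. \<bar>f (\<theta> g x) - f (\<theta> d x)\<bar> \<le> \<epsilon>))"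
  have D: "countable D \<and> D \<subseteq> carrier G \<and>
        (\<forall>g\<in>carrier G. \<forall>\<epsilon>>0. \<exists>d\<in>D. \<forall>x\<in>topspace K. \<bar>f (\<theta> g x) - f (\<theta> d x)\<bar> \<le> \<epsilon>)"
    unfolding D_def by (rule someI_ex [OF exists_countable_orbit_net [OF f]])
  have net: "orbit_net f = insert f ((\<lambda>d. f \<circ> \<theta> d) ` D)"
    by (simp add: orbit_net_def D_def)
  show "countable (orbit_net f)"
    using D by (simp add: net)
  show "\<exists>h\<in>orbit_net f. \<forall>x\<in>topspace K. \<bar>f (\<theta> g x) - h x\<bar> \<le> \<epsilon>" if "g \<in> carrier G" "\<epsilon> > 0"
    using D that by (fastforce simp: net)
  show "\<exists>d\<in>carrier G. \<forall>x\<in>topspace K. h x = f (\<theta> d x)" if "h \<in> orbit_net f"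
  proof (cases "h = f")
    case True
    then show ?thesis
      by (intro bexI [of _ \<one>]) (auto simp: action_one)
  qed (use that D in \<open>auto simp: net\<close>)
qed

lemma orbit_net_self: "f \<in> orbit_net f"
  by (simp add: orbit_net_def)

lemma continuous_map_orbit_net:
  assumes "continuous_map K euclideanreal f" "h \<in> orbit_net f"
  shows "continuous_map K euclideanreal h"
proof -
  obtain d where d: "d \<in> carrier G" "\<forall>x\<in>topspace K. h x = f (\<theta> d x)"
    using orbit_net_translate [OF assms] by blast
  have "continuous_map K euclideanreal (f \<circ> \<theta> d)"
    by (rule continuous_map_compose [OF continuous_map_action [OF d(1)] assms(1)])
  then show ?thesis
    by (rule continuous_map_eq) (use d in auto)
qed

lemma continuous_map_translate:
  assumes f: "continuous_map K euclideanreal f" and A: "orbit_net f \<subseteq> A" and g: "g \<in> carrier G"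
  shows "continuous_map (initial_topology (topspace K) A) euclideanreal (\<lambda>x. f (\<theta> g x))"
proof -
  have "\<exists>h\<in>orbit_net f. \<forall>x\<in>topspace K. \<bar>f (\<theta> g x) - h x\<bar> \<le> 1 / Suc n" for n
    by (rule orbit_net_approximates [OF f g]) simp
  then obtain h where h: "\<And>n. h n \<in> orbit_net f"
      "\<And>n x. x \<in> topspace K \<Longrightarrow> \<bar>f (\<theta> g x) - h n x\<bar> \<le> 1 / Suc n"
    by metis
  have "continuous_map (initial_topology (topspace K) A) Met_TC.mtopology (\<lambda>x. f (\<theta> g x))"
  proof (rule Met_TC.continuous_map_uniform_limit [where F = sequentially and f = h])
    show "\<forall>\<^sub>F n in sequentially. continuous_map (initial_topology (topspace K) A) Met_TC.mtopology (h n)"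
      using h(1) A by (intro always_eventually allI) (auto intro: continuous_map_initial_topology)
    fix \<epsilon> :: real assume "0 < \<epsilon>"
    then have "\<forall>\<^sub>F n in sequentially. inverse (real (Suc n)) < \<epsilon>"
      using order_tendstoD(2) [OF LIMSEQ_inverse_real_of_nat] by simp
    then show "\<forall>\<^sub>F n in sequentially. \<forall>x\<in>topspace (initial_topology (topspace K) A).
                 f (\<theta> g x) \<in> UNIV \<and> dist (h n x) (f (\<theta> g x)) < \<epsilon>"
    proof eventually_elim
      case (elim n)
      then show ?case
        using h(2) [of _ n] by (fastforce simp: dist_real_def abs_minus_commute divide_inverse)
    qed
  qed simp
  then show ?thesis
    by simp
qed

text \<open>Families of this form are closed under unions, as limit stages of a system require, and yet
  they are built from countable pieces. Invariance holds only for the topology they generate: a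
  translate of a function in \<open>A\<close> is a uniform limit of functions in \<open>A\<close>.\<close>
definition invariant_family :: "('k \<Rightarrow> real) set \<Rightarrow> bool" where
  "invariant_family A \<longleftrightarrow>
     (\<exists>F. (\<forall>f\<in>F. continuous_map K euclideanreal f) \<and> A = (\<Union>f\<in>F. orbit_net f))"

lemma invariant_family_continuous:
  "\<lbrakk>invariant_family A; f \<in> A\<rbrakk> \<Longrightarrow> continuous_map K euclideanreal f"
  unfolding invariant_family_def using continuous_map_orbit_net by blast

lemma continuous_map_action_initial_topology:
  assumes "invariant_family A" and g: "g \<in> carrier G"
  shows "continuous_map (initial_topology (topspace K) A) (initial_topology (topspace K) A) (\<theta> g)"
proof (rule continuous_map_into_initial_topology)
  show "\<theta> g \<in> topspace (initial_topology (topspace K) A) \<rightarrow> topspace K"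
    using g by (auto intro: action_in)
  obtain F where F: "\<And>f. f \<in> F \<Longrightarrow> continuous_map K euclideanreal f" "A = (\<Union>f\<in>F. orbit_net f)"
    using assms(1) unfolding invariant_family_def by blast
  fix h assume "h \<in> A"
  then obtain f where f: "f \<in> F" "h \<in> orbit_net f"
    using F(2) by blast
  then obtain d where d: "d \<in> carrier G" "\<forall>x\<in>topspace K. h x = f (\<theta> d x)"
    using orbit_net_translate F(1) by blast
  have "continuous_map (initial_topology (topspace K) A) euclideanreal (\<lambda>x. f (\<theta> (d \<otimes> g) x))"
    using f F d g by (intro continuous_map_translate) auto
  then show "continuous_map (initial_topology (topspace K) A) euclideanreal (\<lambda>x. h (\<theta> g x))"
    by (rule continuous_map_eq) (use d g in \<open>auto simp: action_mult action_in\<close>)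
qed

text \<open>Near openness of the passage from \<open>K\<close> to the initial topology, along a dense orbit \<open>M\<close> that contains
  a dense \<open>G\<^sub>\<delta>\<close> set of the initial topology. If all translates \<open>P d\<close> of the small piece of the orbit
  were nowhere dense, then \<open>K\<close> would be a countable union of closed sets with empty interior. So the
  interior \<open>N\<close> of the closure of some \<open>P d\<close> contains a point \<open>d u x\<close>, and it is moved back to \<open>x\<close> by
  the homeomorphism inverse to \<open>d u\<close>.\<close>
lemma nearly_open:
  assumes A: "invariant_family A"
    and E: "countable \<V>" "\<And>V. V \<in> \<V> \<Longrightarrow> openin (initial_topology (topspace K) A) V"
      "\<And>V. V \<in> \<V> \<Longrightarrow> initial_topology (topspace K) A closure_of V = topspace K"
      "topspace K \<inter> \<Inter>\<V> \<subseteq> M"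
    and dense: "K closure_of M = topspace K" "M \<subseteq> topspace K"
    and orbit: "\<And>x y. \<lbrakk>x \<in> M; y \<in> M\<rbrakk> \<Longrightarrow> \<exists>g\<in>carrier G. \<theta> g x = y"
      "\<And>g x. \<lbrakk>g \<in> carrier G; x \<in> M\<rbrakk> \<Longrightarrow> \<theta> g x \<in> M"
    and x: "x \<in> M" and W: "openin K W" "x \<in> W" and cr: "completely_regular_space K"
  obtains V where "openin (initial_topology (topspace K) A) V" "x \<in> V"
    "V \<subseteq> initial_topology (topspace K) A closure_of (W \<inter> M)"
proof -
  let ?I = "initial_topology (topspace K) A"
  have xK: "x \<in> topspace K"
    using x dense(2) by blast
  have "closedin K (topspace K - W) \<and> x \<in> topspace K - (topspace K - W)"
    using W xK by auto
  then obtain f where f: "continuous_map K (top_of_set {0..1::real}) f" "f x = 0" "f ` (topspace K - W) \<subseteq> {1}"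
    using cr unfolding completely_regular_space_def by metis
  have contf: "continuous_map K euclideanreal f"
    using f(1) by (simp add: continuous_map_in_subtopology)
  \<comment> \<open>Two moves by at most \<open>1/3\<close> take the value \<open>0\<close> of \<open>f\<close> at \<open>x\<close> to a value below \<open>1\<close>, so stay in \<open>W\<close>.\<close>
  let ?U = "almost_stabilizer f (1/3)"
  have third: "0 < (1/3 :: real)"
    by simp
  obtain D where D: "countable D" "D \<subseteq> carrier G"
      "\<forall>g\<in>carrier G. \<exists>d\<in>D. \<exists>u\<in>?U. g = d \<otimes> u"
    using almost_stabilizer_covers [OF contf third] by meson
  define P where "P d = (\<lambda>u. \<theta> (d \<otimes> u) x) ` ?U" for d
  have U: "?U \<subseteq> carrier G"
    by (auto simp: almost_stabilizer_def)
  have PO: "P d \<subseteq> M" if "d \<in> D" for d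
    using that D(2) U x by (auto simp: P_def subset_iff intro!: orbit(2))
  have cover: "M \<subseteq> (\<Union>d\<in>D. P d)"
  proof
    fix y assume "y \<in> M"
    then obtain g where g: "g \<in> carrier G" "\<theta> g x = y"
      using orbit(1) x by blast
    then obtain d u where "d \<in> D" "u \<in> ?U" "g = d \<otimes> u"
      using D(3) by blast
    then show "y \<in> (\<Union>d\<in>D. P d)"
      using g(2) by (auto simp: P_def)
  qed
  have "\<exists>d\<in>D. ?I interior_of (?I closure_of (P d)) \<noteq> {}"
  proof (rule ccontr)
    assume none: "\<not> ?thesis"
    define \<G> where "\<G> = (\<lambda>d. ?I closure_of (P d)) ` D \<union> (\<lambda>V. topspace K - V) ` \<V>"
    have "?I interior_of (\<Union>\<G>) = {}"
    proof (rule Baire_category_alt)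
      show "completely_metrizable_space ?I \<or> locally_compact_space ?I \<and> regular_space ?I"
        using regular_space_initial_topology compact_imp_locally_compact_space
          compact_space_initial_topology [OF compact invariant_family_continuous [OF A]] by blast
      show "countable \<G>"
        using D(1) E(1) by (simp add: \<G>_def)
      show "closedin ?I C \<and> ?I interior_of C = {}" if "C \<in> \<G>" for C
      proof -
        consider d where "d \<in> D" "C = ?I closure_of (P d)" | V where "V \<in> \<V>" "C = topspace K - V"
          using \<open>C \<in> \<G>\<close> by (auto simp: \<G>_def)
        then show ?thesis
        proof cases
          case 1
          then show ?thesis
            using none by auto
        next
          case 2
          have "closedin ?I (topspace ?I - V)"
            by (rule closedin_diff [OF closedin_topspace E(2) [OF 2(1)]])
          moreover have "?I interior_of (topspace ?I - V) = {}"
            using E(3) [OF 2(1)] closure_of_eq_topspace [of ?I V] by simp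
          ultimately show ?thesis
            using 2(2) by simp
        qed
      qed
    qed
    moreover have "topspace K \<subseteq> \<Union>\<G>"
    proof
      fix y assume y: "y \<in> topspace K"
      show "y \<in> \<Union>\<G>"
      proof (cases "y \<in> \<Inter>\<V>")
        case True
        then obtain d where "d \<in> D" "y \<in> P d"
          using E(4) y cover by blast
        moreover have "P d \<subseteq> ?I closure_of (P d)"
          using PO [OF \<open>d \<in> D\<close>] dense(2) by (intro closure_of_subset) auto
        ultimately show ?thesis
          by (auto simp: \<G>_def)
      qed (use y in \<open>auto simp: \<G>_def\<close>)
    qed
    then have "?I interior_of (\<Union>\<G>) \<supseteq> topspace ?I"
      using openin_topspace [of ?I] by (intro interior_of_maximal) auto
    ultimately show False
      using xK by auto
  qed
  then obtain d where d: "d \<in> D" "?I interior_of (?I closure_of (P d)) \<noteq> {}"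
    by blast
  define N where "N = ?I interior_of (?I closure_of (P d))"
  have N: "openin ?I N" "N \<subseteq> ?I closure_of (P d)" "N \<noteq> {}"
    using d(2) by (auto simp: N_def interior_of_subset)
  then obtain y where "y \<in> N" "y \<in> P d"
    by (metis equals0I in_closure_of subsetD)
  then obtain u where u: "u \<in> ?U" "\<theta> (d \<otimes> u) x \<in> N"
    by (auto simp: P_def)
  define g where "g = d \<otimes> u"
  have uG: "u \<in> carrier G" and dG: "d \<in> carrier G" and gG: "g \<in> carrier G"
    using u(1) U d(1) D(2) by (auto simp: g_def)
  define V where "V = {z \<in> topspace K. \<theta> g z \<in> N}"
  have "openin ?I V"
    using openin_continuous_map_preimage [OF continuous_map_action_initial_topology [OF A gG] N(1)]
    by (simp add: V_def)
  moreover have "x \<in> V"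
    using u(2) xK by (simp add: V_def g_def)
  moreover have "V \<subseteq> ?I closure_of (W \<inter> M)"
  proof
    fix z assume z: "z \<in> V"
    then have zK: "z \<in> topspace K" and "\<theta> g z \<in> ?I closure_of (P d)"
      using N(2) by (auto simp: V_def)
    then have "\<theta> (inv g) (\<theta> g z) \<in> \<theta> (inv g) ` (?I closure_of (P d))"
      by blast
    also have "\<dots> \<subseteq> ?I closure_of (\<theta> (inv g) ` P d)"
      using gG by (intro continuous_map_image_closure_subset continuous_map_action_initial_topology A) simp
    also have "\<dots> \<subseteq> ?I closure_of (W \<inter> M)"
    proof (rule closure_of_mono)
      show "\<theta> (inv g) ` P d \<subseteq> W \<inter> M"
      proof
        fix w assume "w \<in> \<theta> (inv g) ` P d"
        then obtain v where v: "v \<in> ?U" "w = \<theta> (inv g) (\<theta> (d \<otimes> v) x)"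
          by (auto simp: P_def)
        have vG: "v \<in> carrier G"
          using v(1) U by blast
        \<comment> \<open>The factor \<open>d\<close> cancels; then \<open>f w\<close> is compared with \<open>f (v x)\<close> by \<open>u\<close>, and this with \<open>f x = 0\<close> by \<open>v\<close>.\<close>
        have w_eq: "w = \<theta> (inv u) (\<theta> v x)"
        proof -
          have "inv g \<otimes> (d \<otimes> v) = inv u \<otimes> v"
            using uG vG dG by (simp add: g_def inv_mult_group m_assoc [symmetric])
              (simp add: m_assoc)
          then show ?thesis
            using v(2) gG uG vG dG xK action_mult [of "inv g" "d \<otimes> v" x] action_mult [of "inv u" v x]
            by simp
        qed
        have wO: "w \<in> M"
          using w_eq uG vG x orbit(2) by simp
        have "\<theta> u w = \<theta> v x"
          using action_inv [of "inv u" "\<theta> v x"] uG vG xK w_eq by (simp add: action_in)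
        then have "\<bar>f (\<theta> v x) - f w\<bar> \<le> 1/3"
          using u(1) wO dense(2) unfolding almost_stabilizer_def by fastforce
        moreover have "\<bar>f (\<theta> v x) - f x\<bar> \<le> 1/3"
          using v(1) xK unfolding almost_stabilizer_def by blast
        ultimately have "f w < 1"
          using f(2) by linarith
        then have "w \<in> W"
          using f(3) wO dense(2) by fastforce
        then show "w \<in> W \<inter> M"
          using wO by blast
      qed
    qed
    finally show "z \<in> ?I closure_of (W \<inter> M)"
      using action_inv [OF gG zK] by simp
  qed
  ultimately show thesis
    using that by blast
qed

end

section \<open>Quotients of a transitive space\<close>

text \<open>The sets \<open>\<V>\<close> and \<open>\<C>\<close> witness that \<open>X\<close> contains a dense Cech-complete \<open>k\<close>-separable subspace, whose
  image is the intersection of \<open>\<V>\<close> and contains the union of \<open>\<C>\<close>.\<close>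
locale transitive_compactification =
  omega_narrow_compact_action G T K \<theta>
  for G :: "('g, 'm) monoid_scheme" (structure) and T :: "'g topology"
    and K :: "'k topology" and \<theta> :: "'g \<Rightarrow> 'k \<Rightarrow> 'k" +
  fixes X :: "'a topology" and c :: "'a \<Rightarrow> 'k" and \<V> \<C> :: "'k set set"
  assumes Hausdorff: "Hausdorff_space X"
    and compactification: "compactification X K c"
    and transitive: "\<And>x y. \<lbrakk>x \<in> topspace X; y \<in> topspace X\<rbrakk> \<Longrightarrow> \<exists>g\<in>carrier G. \<theta> g (c x) = c y"
    and stable: "\<And>g x. \<lbrakk>g \<in> carrier G; x \<in> topspace X\<rbrakk> \<Longrightarrow> \<theta> g (c x) \<in> c ` topspace X"
    and countable_opens: "countable \<V>" and opens: "\<And>V. V \<in> \<V> \<Longrightarrow> openin K V"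
    and countable_compacts: "countable \<C>" and compacts: "\<And>C. C \<in> \<C> \<Longrightarrow> compactin K C"
    and core: "topspace K \<inter> \<Inter>\<V> \<subseteq> c ` topspace X" "\<Union>\<C> \<subseteq> \<Inter>\<V>"
    and compacts_dense: "K closure_of (\<Union>\<C>) = topspace K"
begin

lemma Hausdorff_K: "Hausdorff_space K" and embedding: "embedding_map X K c"
  and dense: "K closure_of (c ` topspace X) = topspace K" and image_c: "c ` topspace X \<subseteq> topspace K"
  using compactification by (auto simp: compactification_def dense_in_def)

lemma completely_regular_K: "completely_regular_space K"
  by (intro compact Hausdorff_K compact_imp_locally_compact_space
      locally_compact_regular_imp_completely_regular_space
      compact_Hausdorff_imp_regular_space disjI1)

lemma continuous_c: "continuous_map X K c" and inj_c: "inj_on c (topspace X)"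
  using embedding unfolding embedding_map_def
  by (auto dest: homeomorphic_imp_continuous_map homeomorphic_imp_injective_map
      simp: continuous_map_in_subtopology)

lemma openin_trace:
  assumes "openin X U"
  obtains W where "openin K W" "c ` U = W \<inter> c ` topspace X"
proof -
  have "openin (subtopology K (c ` topspace X)) (c ` U)"
    using embedding assms homeomorphic_imp_open_map unfolding embedding_map_def open_map_def by blast
  then show thesis
    using that unfolding openin_subtopology by blast
qed

definition separator :: "'k set \<Rightarrow> 'k set \<Rightarrow> 'k \<Rightarrow> real" where
  "separator V C = (SOME \<phi>. continuous_map K euclideanreal \<phi> \<and> \<phi> ` C \<subseteq> {0} \<and>
     \<phi> ` (topspace K - V) \<subseteq> {1})"

lemma separator:
  assumes "V \<in> \<V>" "C \<in> \<C>"
  shows "continuous_map K euclideanreal (separator V C)"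
    and "x \<in> C \<Longrightarrow> separator V C x = 0"
    and "\<lbrakk>x \<in> topspace K; x \<notin> V\<rbrakk> \<Longrightarrow> separator V C x = 1"
proof -
  have "disjnt C (topspace K - V)"
    using core(2) assms by (auto simp: disjnt_iff)
  then obtain \<phi> :: "'k \<Rightarrow> real" where "continuous_map K euclideanreal \<phi>" "\<phi> ` (topspace K - V) \<subseteq> {1}"
      "\<phi> ` C \<subseteq> {0}"
    using Urysohn_completely_regular_compact_closed_alt
      [OF completely_regular_K compacts [OF assms(2)], of "topspace K - V" 1 0]
      opens [OF assms(1)] by auto
  then have ex: "\<exists>\<phi>. continuous_map K euclideanreal \<phi> \<and> \<phi> ` C \<subseteq> {0} \<and>
     \<phi> ` (topspace K - V) \<subseteq> {1::real}"
    by blast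
  have *: "continuous_map K euclideanreal (separator V C) \<and> separator V C ` C \<subseteq> {0} \<and>
     separator V C ` (topspace K - V) \<subseteq> {1}"
    unfolding separator_def by (rule someI_ex [OF ex])
  then show "continuous_map K euclideanreal (separator V C)"
    and "x \<in> C \<Longrightarrow> separator V C x = 0"
    and "\<lbrakk>x \<in> topspace K; x \<notin> V\<rbrakk> \<Longrightarrow> separator V C x = 1"
    by auto
qed

definition separators :: "('k \<Rightarrow> real) set" where
  "separators = (\<Union>V\<in>\<V>. \<Union>C\<in>\<C>. {separator V C})"

lemma countable_separators: "countable separators"
  unfolding separators_def using countable_opens countable_compacts by auto

text \<open>For fixed \<open>V\<close>, some separator is below \<open>1\<close> on a set that is open in the initial topology,
  dense since it contains all of \<open>\<C>\<close>, and contained in \<open>V\<close>. The intersection of these sets is the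
  \<open>G\<^sub>\<delta>\<close> set on which the Baire argument rests.\<close>
lemma nearly_open_trace:
  assumes A: "invariant_family A" "separators \<subseteq> A" and U: "openin K W" "x \<in> topspace X" "c x \<in> W"
  obtains V where "openin (initial_topology (topspace K) A) V" "c x \<in> V"
    "V \<subseteq> initial_topology (topspace K) A closure_of (W \<inter> c ` topspace X)"
proof (rule nearly_open [OF A(1), where \<V> = "(\<lambda>V. \<Union>C\<in>\<C>. {z \<in> topspace K. separator V C z \<in> {..<1}}) ` \<V>"
        and M = "c ` topspace X" and W = W and x = "c x"])
  let ?I = "initial_topology (topspace K) A"
  show "countable ((\<lambda>V. \<Union>C\<in>\<C>. {z \<in> topspace K. separator V C z \<in> {..<1}}) ` \<V>)"
    using countable_opens by simp
  fix N assume "N \<in> (\<lambda>V. \<Union>C\<in>\<C>. {z \<in> topspace K. separator V C z \<in> {..<1}}) ` \<V>"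
  then obtain V where V: "V \<in> \<V>" "N = (\<Union>C\<in>\<C>. {z \<in> topspace K. separator V C z \<in> {..<1}})"
    by blast
  have "openin ?I {z \<in> topspace ?I. separator V C z \<in> {..<1}}" if "C \<in> \<C>" for C
  proof (rule openin_continuous_map_preimage [where Y = euclideanreal])
    show "continuous_map ?I euclideanreal (separator V C)"
      using A(2) V(1) that by (intro continuous_map_initial_topology) (auto simp: separators_def)
  qed simp
  then show "openin ?I N"
    unfolding V(2) by (intro openin_Union) auto
  have "continuous_map K ?I (\<lambda>x. x)"
    using A(1) by (intro continuous_map_into_initial_topology) (auto intro: invariant_family_continuous)
  then have "(\<lambda>x. x) ` (K closure_of \<Union>\<C>) \<subseteq> ?I closure_of ((\<lambda>x. x) ` \<Union>\<C>)"
    by (rule continuous_map_image_closure_subset)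
  then have "topspace K \<subseteq> ?I closure_of \<Union>\<C>"
    by (simp add: compacts_dense)
  also have "\<dots> \<subseteq> ?I closure_of N"
  proof (rule closure_of_mono)
    show "\<Union>\<C> \<subseteq> N"
    proof
      fix z assume "z \<in> \<Union>\<C>"
      then obtain C where C: "C \<in> \<C>" "z \<in> C" by blast
      then have "z \<in> topspace K"
        using compactin_subset_topspace [OF compacts [OF C(1)]] by blast
      then show "z \<in> N"
        using separator(2) [OF V(1) C] C(1) by (auto simp: V(2) intro!: bexI [of _ C])
    qed
  qed
  finally show "?I closure_of N = topspace K"
    using closure_of_subset_topspace [of ?I N] by simp
next
  show "topspace K \<inter> \<Inter>((\<lambda>V. \<Union>C\<in>\<C>. {z \<in> topspace K. separator V C z \<in> {..<1}}) ` \<V>) \<subseteq> c ` topspace X"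
  proof -
    have "z \<in> V" if "z \<in> topspace K" "V \<in> \<V>" "C \<in> \<C>" "separator V C z < 1" for z V C
      using separator(3) [OF that(2,3,1)] that(4) by force
    then show ?thesis
      using core(1) by fastforce
  qed
qed (use dense image_c transitive stable U completely_regular_K in auto)

definition pulled_back_orbits :: "('k \<Rightarrow> real) set \<Rightarrow> ('a \<Rightarrow> real) set" where
  "pulled_back_orbits F = (\<lambda>f. f \<circ> c) ` (\<Union>f\<in>F. orbit_net f)"

lemma
  assumes "\<And>f. f \<in> F \<Longrightarrow> continuous_map K euclideanreal f" "separators \<subseteq> F"
  shows invariant_orbits: "invariant_family (\<Union>f\<in>F. orbit_net f)"
    and separators_orbits: "separators \<subseteq> (\<Union>f\<in>F. orbit_net f)"
  using assms orbit_net_self unfolding invariant_family_def by blast+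

lemma continuous_pulled_back_orbits:
  assumes F: "\<And>f. f \<in> F \<Longrightarrow> continuous_map K euclideanreal f" and "h \<in> pulled_back_orbits F"
  shows "continuous_map X euclideanreal h"
  using assms continuous_map_orbit_net continuous_map_compose [OF continuous_c]
  unfolding pulled_back_orbits_def by blast

lemma skeletal_quotient:
  assumes F: "\<And>f. f \<in> F \<Longrightarrow> continuous_map K euclideanreal f" "separators \<subseteq> F"
  shows "skeletal_map X (separated_quotient (topspace X) (pulled_back_orbits F))
           (representative (topspace X) (pulled_back_orbits F))"
proof (rule skeletal_map_representative [OF continuous_pulled_back_orbits [OF F(1)]])
  let ?A = "\<Union>f\<in>F. orbit_net f" and ?E = "topspace X"
  let ?I = "initial_topology (topspace K) ?A" and ?J = "initial_topology ?E (pulled_back_orbits F)"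
  fix U x assume U: "openin X U" "x \<in> U"
  then have UX: "U \<subseteq> ?E"
    by (simp add: openin_subset)
  obtain W where W: "openin K W" "c ` U = W \<inter> c ` ?E"
    using openin_trace [OF U(1)] .
  obtain V where V: "openin ?I V" "c x \<in> V" "V \<subseteq> ?I closure_of (W \<inter> c ` ?E)"
    using nearly_open_trace [OF invariant_orbits [OF F] separators_orbits [OF F] W(1), of x] U(2) UX W(2)
    by blast
  have "openin ?J {z \<in> ?E. c z \<in> V}"
    unfolding pulled_back_orbits_def by (rule openin_initial_topology_preimage [OF V(1) image_c])
  moreover have "{z \<in> ?E. c z \<in> V} \<subseteq> ?J closure_of U"
  proof
    fix z assume z: "z \<in> {z \<in> ?E. c z \<in> V}"
    show "z \<in> ?J closure_of U"
      unfolding in_closure_of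
    proof (intro conjI allI impI)
      fix N assume N: "z \<in> N \<and> openin ?J N"
      then obtain N' where N': "openin ?I N'" "N = {x \<in> ?E. c x \<in> N'}"
        unfolding pulled_back_orbits_def using openin_initial_topology_pullback [OF _ image_c] by metis
      have "c z \<in> ?I closure_of (c ` U)"
        using z V(3) W(2) by auto
      then obtain w where "w \<in> c ` U" "w \<in> N'"
        using N N' unfolding in_closure_of by blast
      then show "\<exists>y. y \<in> U \<and> y \<in> N"
        using UX N'(2) by auto
    qed (use z in auto)
  qed
  ultimately show "\<exists>V. openin ?J V \<and> x \<in> V \<and> V \<subseteq> ?J closure_of U"
    using U(2) UX V(2) by blast
qed

text \<open>If \<open>\<C>\<close> covers \<open>X\<close>, a point of \<open>K\<close> that no function of the family distinguishes from a point of
  \<open>X\<close> lies in every \<open>V\<close>, hence in \<open>X\<close>. A neighbourhood \<open>W'\<close> with closure inside \<open>W\<close> is then enough: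
  points in the coarse closure of \<open>W'\<close> agree under the family with points of the compact closure of \<open>W'\<close>
  in \<open>K\<close>, and these belong to \<open>W\<close> and to \<open>X\<close>.\<close>
lemma open_quotient:
  assumes F: "\<And>f. f \<in> F \<Longrightarrow> continuous_map K euclideanreal f" "separators \<subseteq> F"
    and sigma: "c ` topspace X \<subseteq> \<Union>\<C>"
  shows "open_map X (separated_quotient (topspace X) (pulled_back_orbits F))
           (representative (topspace X) (pulled_back_orbits F))"
  unfolding open_map_def
proof (intro allI impI)
  let ?A = "\<Union>f\<in>F. orbit_net f" and ?E = "topspace X"
  let ?I = "initial_topology (topspace K) ?A" and ?J = "initial_topology ?E (pulled_back_orbits F)"
  let ?r = "representative ?E (pulled_back_orbits F)" and ?Q = "separated_quotient ?E (pulled_back_orbits F)"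
  fix U assume U: "openin X U"
  then have UX: "U \<subseteq> ?E"
    by (simp add: openin_subset)
  obtain W where W: "openin K W" "c ` U = W \<inter> c ` ?E"
    using openin_trace [OF U(1)] .
  have saturated: "y \<in> c ` ?E"
    if zy: "z \<in> ?E" "y \<in> topspace K" "\<forall>f\<in>?A. f y = f (c z)" for y z
  proof -
    obtain C where C: "C \<in> \<C>" "c z \<in> C"
      using sigma zy(1) by blast
    have "y \<in> V" if V: "V \<in> \<V>" for V
    proof -
      have "separator V C \<in> ?A"
        using separators_orbits [OF F] C(1) V by (auto simp: separators_def)
      with zy(3) have "separator V C y = separator V C (c z)"
        by (rule bspec)
      then show ?thesis
        using separator(2) [OF V C] separator(3) [OF V C(1) zy(2)] by force
    qed
    then show ?thesis
      using core(1) zy(2) by blast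
  qed
  show "openin ?Q (?r ` U)"
  proof (subst openin_subopen, intro ballI)
    fix q assume "q \<in> ?r ` U"
    then obtain u where u: "u \<in> U" "q = ?r u" by blast
    then have "c u \<in> W" "u \<in> ?E"
      using W(2) UX by auto
    then have "closedin K (topspace K - W) \<and> c u \<in> topspace K - (topspace K - W)"
      using W(1) image_c by auto
    then obtain W' where W': "openin K W'" "c u \<in> W'" "disjnt (topspace K - W) (K closure_of W')"
      using completely_regular_imp_regular_space [OF completely_regular_K]
      unfolding regular_space by meson
    obtain V where V: "openin ?I V" "c u \<in> V" "V \<subseteq> ?I closure_of (W' \<inter> c ` ?E)"
      using nearly_open_trace [OF invariant_orbits [OF F] separators_orbits [OF F] W'(1) \<open>u \<in> ?E\<close> W'(2)]
      by blast
    let ?V = "{z \<in> ?E. c z \<in> V}"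
    have Vopen: "openin ?J ?V"
      unfolding pulled_back_orbits_def by (rule openin_initial_topology_preimage [OF V(1) image_c])
    then have "openin ?Q (?V \<inter> ?r ` ?E)"
      unfolding separated_quotient_def openin_subtopology by blast
    moreover have "q \<in> ?V \<inter> ?r ` ?E"
      using openin_initial_topology_saturated [OF Vopen, of u "?r u"] V(2) \<open>u \<in> ?E\<close> u(2)
      by (auto simp: representative_in representative_eq)
    moreover have "?V \<inter> ?r ` ?E \<subseteq> ?r ` U"
    proof
      fix z assume z: "z \<in> ?V \<inter> ?r ` ?E"
      have "W' \<inter> c ` ?E \<subseteq> K closure_of W'"
        using closure_of_subset [OF openin_subset [OF W'(1)]] by blast
      then have "c z \<in> ?I closure_of (K closure_of W')"
        using z V(3) closure_of_mono [of "W' \<inter> c ` ?E" "K closure_of W'" ?I] by blast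
      moreover have "compactin K (K closure_of W')"
        by (rule closedin_compact_space [OF compact closedin_closure_of])
      ultimately obtain y where y: "y \<in> K closure_of W'" "\<forall>f\<in>?A. f y = f (c z)"
        using closure_of_compactin_initial_topology [of K "K closure_of W'" ?A "c z"]
          invariant_family_continuous [OF invariant_orbits [OF F]] by blast
      then have yK: "y \<in> topspace K"
        by (meson closure_of_subset_topspace subsetD)
      then have "y \<in> W"
        using y(1) W'(3) by (auto simp: disjnt_iff)
      then have "y \<in> c ` U"
        using saturated [OF _ yK y(2)] z W(2) by blast
      then obtain v where v: "v \<in> U" "y = c v" by blast
      have "?r v = ?r z"
        by (rule representative_cong) (use y(2) v(2) in \<open>auto simp: pulled_back_orbits_def\<close>)
      also have "\<dots> = z"
        using z by (intro representative_fixed) simp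
      finally show "z \<in> ?r ` U"
        using v(1) by blast
    qed
    ultimately show "\<exists>V. openin ?Q V \<and> q \<in> V \<and> V \<subseteq> ?r ` U"
      by blast
  qed
qed

text \<open>For each point and open neighbourhood, the orbit net of one Urysohn function is added to the
  system, so that the functions together generate the topology of \<open>X\<close>. The separators belong to the
  family at the first index already.\<close>
lemma dugundji_wrt_orbit_quotients:
  assumes cancel: "\<And>Y Z f g h. \<lbrakk>continuous_map X Y h; h ` topspace X = topspace Y;
                   continuous_map Y Z g; \<And>x. x \<in> topspace X \<Longrightarrow> g (h x) = f x; Q X Z f\<rbrakk>
                   \<Longrightarrow> Q Y Z g"
    and Q: "\<And>F. \<lbrakk>\<And>f. f \<in> F \<Longrightarrow> continuous_map K euclideanreal f; separators \<subseteq> F\<rbrakk> \<Longrightarrow>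
      Q X (separated_quotient (topspace X) (pulled_back_orbits F)) (representative (topspace X) (pulled_back_orbits F))"
  shows "dugundji_wrt Q X"
proof -
  define P where "P x W \<phi> \<longleftrightarrow> continuous_map K euclideanreal \<phi> \<and>
      (openin X W \<and> x \<in> W \<longrightarrow> \<phi> (c x) = (0::real) \<and> (\<forall>y\<in>topspace X - W. \<phi> (c y) = 1))" for x W \<phi>
  have ex: "\<exists>\<phi>. P x W \<phi>" for x W
  proof (cases "openin X W \<and> x \<in> W")
    case True
    then obtain W' where W': "openin K W'" "c ` W = W' \<inter> c ` topspace X"
      using openin_trace by blast
    have WX: "W \<subseteq> topspace X"
      using True openin_subset by blast
    then have "closedin K (topspace K - W') \<and> c x \<in> topspace K - (topspace K - W')"
      using W' image_c True by auto
    then obtain \<phi> :: "'k \<Rightarrow> real" where \<phi>: "continuous_map K (top_of_set {0..1}) \<phi>" "\<phi> (c x) = 0"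
        "\<phi> ` (topspace K - W') \<subseteq> {1}"
      using completely_regular_K unfolding completely_regular_space_def by meson
    have "\<phi> (c y) = 1" if y: "y \<in> topspace X - W" for y
    proof -
      have "c y \<notin> c ` W"
        using y WX inj_c by (auto dest: inj_onD)
      then have "c y \<in> topspace K - W'"
        using W'(2) y image_c by auto
      then show ?thesis
        using \<phi>(3) by blast
    qed
    then show ?thesis
      using \<phi> by (intro exI [of _ \<phi>]) (auto simp: P_def continuous_map_in_subtopology)
  qed (intro exI [of _ "\<lambda>_. 0"], auto simp: P_def)
  define \<phi> where "\<phi> x W = (SOME \<phi>. P x W \<phi>)" for x W
  have "P x W (\<phi> x W)" for x W
    unfolding \<phi>_def by (rule someI_ex [OF ex])
  then have \<phi>: "\<And>x W. continuous_map K euclideanreal (\<phi> x W)"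
        "\<And>x W. \<lbrakk>openin X W; x \<in> W\<rbrakk> \<Longrightarrow> \<phi> x W (c x) = 0"
        "\<And>x y W. \<lbrakk>openin X W; x \<in> W; y \<in> topspace X - W\<rbrakk> \<Longrightarrow> \<phi> x W (c y) = 1"
    unfolding P_def by blast+
  define S where "S j = pulled_back_orbits {\<phi> (fst j) (snd j)}" for j
  have sep: "continuous_map K euclideanreal f" if "f \<in> separators" for f
    using that separator(1) by (auto simp: separators_def)
  have union: "pulled_back_orbits separators \<union> (\<Union>j\<in>J. S j) =
      pulled_back_orbits (separators \<union> (\<lambda>j. \<phi> (fst j) (snd j)) ` J)" for J
    by (auto simp: S_def pulled_back_orbits_def)
  have cont: "continuous_map K euclideanreal f"
    if "f \<in> separators \<union> (\<lambda>j. \<phi> (fst j) (snd j)) ` J" for f J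
    using that sep \<phi>(1) by blast
  show ?thesis
  proof (rule dugundji_wrt_separated_quotients [where B = "pulled_back_orbits separators" and S = S])
    show "initial_topology (topspace X) (pulled_back_orbits separators \<union> (\<Union>j. S j)) = X"
      unfolding topology_eq
    proof (intro allI iffI)
      let ?A = "pulled_back_orbits separators \<union> (\<Union>j. S j)"
      fix W
      have "continuous_map X euclideanreal f" if "f \<in> ?A" for f
        using that unfolding union by (rule continuous_pulled_back_orbits [rotated]) (rule cont)
      then have "continuous_map X (initial_topology (topspace X) ?A) (\<lambda>x. x)"
        by (intro continuous_map_into_initial_topology) auto
      then show "openin X W" if W: "openin (initial_topology (topspace X) ?A) W"
        using openin_continuous_map_preimage [OF _ W] openin_subset [OF W]
        by (fastforce simp: Collect_conj_eq Int_absorb1)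
      show "openin (initial_topology (topspace X) ?A) W" if W: "openin X W"
      proof (subst openin_subopen, intro ballI)
        fix x assume x: "x \<in> W"
        let ?N = "{y \<in> topspace (initial_topology (topspace X) ?A). (\<phi> x W \<circ> c) y \<in> {..<1}}"
        have "\<phi> x W \<circ> c \<in> S (x, W)"
          by (auto simp: S_def pulled_back_orbits_def orbit_net_self)
        then have "\<phi> x W \<circ> c \<in> ?A"
          by blast
        then have "openin (initial_topology (topspace X) ?A) ?N"
          by (rule openin_continuous_map_preimage [OF continuous_map_initial_topology]) simp
        moreover have "x \<in> ?N"
          using \<phi>(2) [OF W x] x openin_subset [OF W] by auto
        moreover have "?N \<subseteq> W"
          using \<phi>(3) [OF W x] by force
        ultimately show "\<exists>N. openin (initial_topology (topspace X) ?A) N \<and> x \<in> N \<and> N \<subseteq> W"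
          by blast
      qed
    qed
    show "countable (pulled_back_orbits separators)"
      unfolding pulled_back_orbits_def using countable_separators sep
      by (intro countable_image countable_UN) (auto intro: countable_orbit_net)
    show "countable (S j)" for j
      unfolding S_def pulled_back_orbits_def using \<phi>(1)
      by (intro countable_image countable_UN) (auto intro: countable_orbit_net)
    show "let A = pulled_back_orbits separators \<union> (\<Union>j\<in>J. S j) in
        Q X (separated_quotient (topspace X) A) (representative (topspace X) A)" for J
      unfolding Let_def union by (rule Q [OF cont]) auto
  qed (use Hausdorff card_points_and_subsets cancel in auto)
qed

end

text \<open>A compactification of \<open>X\<close> also compactifies its dense subspace \<open>Y\<close>, which therefore is a \<open>G\<^sub>\<delta>\<close> set
  in it.\<close>
lemma transitive_compactification_of_dense_subspace:
  fixes G (structure)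
  assumes G: "semitopological_group G T" "omega_narrow G T"
    and X: "Hausdorff_space X" "transitive_action G (topspace X) \<theta>"
    and c: "compactification X K c" and \<theta>': "continuous_action G T K \<theta>'"
    and equivariant: "\<forall>g\<in>carrier G. \<forall>x\<in>topspace X. \<theta>' g (c x) = c (\<theta> g x)"
    and Y: "dense_in X Y" "cech_complete_space (subtopology X Y)"
    and D: "countable \<D>" "\<And>C. C \<in> \<D> \<Longrightarrow> compactin (subtopology X Y) C"
      "dense_in (subtopology X Y) (\<Union>\<D>)"
  obtains \<V> where "transitive_compactification G T K \<theta>' X c \<V> ((`) c ` \<D>)"
proof -
  have K: "compact_space K" "Hausdorff_space K" and emb: "embedding_map X K c"
    and dense: "K closure_of (c ` topspace X) = topspace K" and cK: "c ` topspace X \<subseteq> topspace K"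
    using c by (auto simp: compactification_def dense_in_def)
  have contc: "continuous_map X K c"
    using emb homeomorphic_imp_continuous_map continuous_map_in_subtopology
    unfolding embedding_map_def by blast
  have YX: "Y \<subseteq> topspace X"
    using Y(1) by (simp add: dense_in_def)
  have dense_image: "K closure_of (c ` S) = topspace K" if "X closure_of S = topspace X" for S
  proof (rule subset_antisym [OF closure_of_subset_topspace])
    have "c ` topspace X \<subseteq> K closure_of (c ` S)"
      using continuous_map_image_closure_subset [OF contc, of S] that by simp
    then have "K closure_of (c ` topspace X) \<subseteq> K closure_of (c ` S)"
      by (rule closure_of_minimal) simp
    then show "topspace K \<subseteq> K closure_of (c ` S)"
      by (simp add: dense)
  qed
  have "embedding_map (subtopology X Y) K c"
  proof -
    have "homeomorphic_map (subtopology X Y) (subtopology (subtopology K (c ` topspace X)) (c ` Y)) c"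
      by (rule homeomorphic_map_subtopologies [OF emb [unfolded embedding_map_def]])
        (use YX cK in auto)
    then show ?thesis
      using YX by (simp add: embedding_map_def subtopology_subtopology Int_absorb1 image_mono)
  qed
  moreover have "K closure_of (c ` Y) = topspace K"
    using dense_image Y(1) by (simp add: dense_in_def)
  ultimately have "compactification (subtopology X Y) K c"
    using K cK YX by (auto simp: compactification_def dense_in_def Int_absorb1)
  then obtain \<V> where V: "countable \<V>" "\<And>V. V \<in> \<V> \<Longrightarrow> openin K V"
      "topspace K \<inter> \<Inter>\<V> = c ` topspace (subtopology X Y)"
    using cech_complete_gdelta_in_compactification Y(2) by metis
  have DY: "\<Union>\<D> \<subseteq> Y"
    using D(3) by (simp add: dense_in_def)
  have "X closure_of \<Union>\<D> = topspace X"
  proof (rule subset_antisym [OF closure_of_subset_topspace])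
    have "Y \<subseteq> X closure_of \<Union>\<D>"
      using D(3) YX DY by (auto simp: dense_in_def closure_of_subtopology Int_absorb1)
    then have "X closure_of Y \<subseteq> X closure_of \<Union>\<D>"
      by (rule closure_of_minimal) simp
    then show "topspace X \<subseteq> X closure_of \<Union>\<D>"
      using Y(1) by (simp add: dense_in_def)
  qed
  then have "K closure_of (c ` \<Union>\<D>) = topspace K"
    by (rule dense_image)
  interpret transitive_action G "topspace X" \<theta>
    by (rule X(2))
  have "transitive_compactification G T K \<theta>' X c \<V> ((`) c ` \<D>)"
  proof (intro transitive_compactification.intro omega_narrow_compact_action.intro
      transitive_compactification_axioms.intro)
    show "Group.group G" "topspace T = carrier G"
      using G(1) by (auto simp: semitopological_group_def)
    show "omega_narrow G T" "continuous_action G T K \<theta>'" "compact_space K" "Hausdorff_space X"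
      "compactification X K c"
      by (rule G \<theta>' K X c)+
    show "\<exists>g\<in>carrier G. \<theta>' g (c x) = c y" if "x \<in> topspace X" "y \<in> topspace X" for x y
      using unique_orbit [OF that] equivariant that(1) by metis
    show "\<theta>' g (c x) \<in> c ` topspace X" if "g \<in> carrier G" "x \<in> topspace X" for g x
      using equivariant element_image [OF that] that by auto
    show "countable ((`) c ` \<D>)"
      using D(1) by simp
    show "compactin K C" if "C \<in> (`) c ` \<D>" for C
      using that D(2) contc by (auto simp: compactin_subtopology intro: image_compactin)
    show "topspace K \<inter> \<Inter>\<V> \<subseteq> c ` topspace X"
      using V(3) by auto
    show "\<Union>((`) c ` \<D>) \<subseteq> \<Inter>\<V>"
    proof -
      have "\<Union>((`) c ` \<D>) \<subseteq> c ` Y"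
        using DY by blast
      also have "\<dots> \<subseteq> \<Inter>\<V>"
        using V(3) YX by (auto simp: Int_absorb1)
      finally show ?thesis .
    qed
    show "K closure_of \<Union>((`) c ` \<D>) = topspace K"
      using \<open>K closure_of (c ` \<Union>\<D>) = topspace K\<close> by (simp add: image_Union)
  qed (use V in auto)
  then show thesis
    by (rule that)
qed

section \<open>Skeletally and openly Dugundji homogeneous spaces\<close>

theorem theorem1p1:
  fixes G :: "('g, 'm) monoid_scheme" and T :: "'g topology"
    and X :: "'a topology" and \<theta> :: "'g \<Rightarrow> 'a \<Rightarrow> 'a"
  assumes "semitopological_group G T" and "tychonoff_space T" and "omega_narrow G T"
    and "tychonoff_space X"
    and "continuous_action G T X \<theta>" and "transitive_action G (topspace X) \<theta>"
    and "\<exists>(K :: 'k topology) c. equivariant_compactification G T X \<theta> K c"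
  shows "((\<exists>Y. dense_in X Y \<and> cech_complete_space (subtopology X Y) \<and>
               k_separable_space (subtopology X Y)) \<longrightarrow> skeletally_dugundji X) \<and>
         (cech_complete_space X \<and> sigma_compact_space X \<longrightarrow> openly_dugundji X)"
proof -
  obtain K :: "'k topology" and c where "equivariant_compactification G T X \<theta> K c"
    using assms(7) by blast
  then obtain \<theta>' where K: "compactification X K c" "continuous_action G T K \<theta>'"
      and equivariant: "\<forall>g\<in>carrier G. \<forall>x\<in>topspace X. \<theta>' g (c x) = c (\<theta> g x)"
    unfolding equivariant_compactification_def by meson
  have Hausdorff: "Hausdorff_space X"
    using assms(4) by (simp add: tychonoff_space_def)
  note compactification_with_core =
    transitive_compactification_of_dense_subspace [where G = G and T = T and X = X and \<theta> = \<theta>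
      and K = K and c = c and \<theta>' = \<theta>', OF assms(1,3) Hausdorff assms(6) K equivariant]
  show ?thesis
  proof (intro conjI impI)
    assume "\<exists>Y. dense_in X Y \<and> cech_complete_space (subtopology X Y) \<and>
              k_separable_space (subtopology X Y)"
    then obtain Y D where Y: "dense_in X Y" "cech_complete_space (subtopology X Y)"
        and D: "dense_in (subtopology X Y) D" "sigma_compact_space (subtopology (subtopology X Y) D)"
      unfolding k_separable_space_def by meson
    have "D \<subseteq> topspace (subtopology X Y)"
      using D(1) unfolding dense_in_def by (rule conjunct1)
    then have "topspace (subtopology (subtopology X Y) D) = D"
      unfolding topspace_subtopology [of "subtopology X Y"] by (rule Int_absorb1)
    then obtain \<D> where \<D>: "countable \<D>" "\<D> \<subseteq> Collect (compactin (subtopology (subtopology X Y) D))"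
        "\<Union>\<D> = D"
      using D(2) unfolding sigma_compact_space_def union_of_def by auto
    have "compactin (subtopology X Y) C" if "C \<in> \<D>" for C
      using \<D>(2) that compactin_subtopology [of "subtopology X Y" D C] by blast
    moreover have "dense_in (subtopology X Y) (\<Union>\<D>)"
      using D(1) unfolding \<D>(3) .
    ultimately obtain \<V> where "transitive_compactification G T K \<theta>' X c \<V> ((`) c ` \<D>)"
      using compactification_with_core [OF Y \<D>(1)] by metis
    then interpret transitive_compactification G T K \<theta>' X c \<V> "(`) c ` \<D>" .
    show "skeletally_dugundji X"
      unfolding skeletally_dugundji_def
      by (rule dugundji_wrt_orbit_quotients) (fact skeletal_map_cancel, fact skeletal_quotient)
  next
    assume "cech_complete_space X \<and> sigma_compact_space X"
    then obtain \<D> where cech: "cech_complete_space X"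
        and \<D>: "countable \<D>" "\<D> \<subseteq> Collect (compactin X)" "\<Union>\<D> = topspace X"
      unfolding sigma_compact_space_def union_of_def by auto
    have "dense_in X (topspace X)"
      by (simp add: dense_in_def)
    then obtain \<V> where "transitive_compactification G T K \<theta>' X c \<V> ((`) c ` \<D>)"
      using compactification_with_core [of "topspace X" \<D>] \<D> cech by auto
    then interpret transitive_compactification G T K \<theta>' X c \<V> "(`) c ` \<D>" .
    have sigma: "c ` topspace X \<subseteq> \<Union>((`) c ` \<D>)"
      using \<D>(3) by blast
    show "openly_dugundji X"
      unfolding openly_dugundji_def
    proof (rule dugundji_wrt_orbit_quotients)
      show "open_map Y Z g"
        if "continuous_map X Y h" "h ` topspace X = topspace Y"
          "\<And>x. x \<in> topspace X \<Longrightarrow> g (h x) = f x" "open_map X Z f"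
        for Y Z :: "'a topology" and f g h
        using that by (rule open_map_cancel)
    qed (rule open_quotient [OF _ _ sigma])
  qed
qed

end
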